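(* For each integer $q\ge3$ put $b^q_k=\sqrt{\frac{3k(q-k)}{q(q+1)}}$ for $0\le k\le q$, $\hat a^q_k=b^q_{k-1}-b^q_k$ for $1\le k\le q$, $\hat{\bf a}^q=(\hat a^q_1,\dots,\hat a^q_q)'$, $$\hat{\bf y}^q=\sqrt{\frac{q(q^2-1)}{12}}\,\frac{\hat{\bf a}^q}{\|\hat{\bf a}^q\|},\qquad \hat{\bf x}^q=\hat{\bf y}^q+\frac{q+1}{2}{\bf e}^q .$$ The sequences of maximal configurations $\{\hat{\bf y}^q\}$ and $\{\hat{\bf x}^q\}$ are not asymptotically permutation-uniform (APU).
   Context: Superscripts $q$ on vectors are indices. ${\bf e}^q=(1,\dots,1)'\in\mathbb{R}^q$; $\|\cdot\|$ is the Euclidean norm. $\widetilde{\mathcal M}^{q-1}=\{{\bf v}\in\mathbb{R}^q : {\bf v}'{\bf e}^q=0\}$, and $\widetilde{\mathcal M}^{q-1}_{\le}$ is the set of ${\bf v}\in\widetilde{\mathcal M}^{q-1}$ with $v_1\le\cdots\le v_q$ (one has $\hat{\bf y}^q\in\widetilde{\mathcal M}^{q-1}_{\le}$). For ${\bf y}\in\mathbb{R}^q$, $\Pi({\bf y})=\{P{\bf y} : P \text{ a } q\times q \text{ permutation matrix}\}$. For $\rho>0$, $\widetilde{\mathcal S}^{q-2}_\rho=\{{\bf v}\in\widetilde{\mathcal M}^{q-1}:\|{\bf v}\|=\rho\}$, and $\widetilde{\bf U}^{q-2}_\rho$ is the uniform (normalized rotation-invariant) probability measure on it. A spherical cap in $\widetilde{\mathcal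 S}^{q-2}_\rho$ is a set $C({\bf w};t)=\{{\bf v}\in\widetilde{\mathcal S}^{q-2}_{\rho}:{\bf v}'{\bf w}>\rho^2t\}$ with ${\bf w}\in\widetilde{\mathcal S}^{q-2}_\rho$ and $-1\le t<1$. For a nonempty finite $N\subset\widetilde{\mathcal S}^{q-2}_\rho$, the normalized spherical cap discrepancy is $D^{q-2}(N)=\sup\{\,|\,|N\cap C|/|N|-\widetilde{\bf U}^{q-2}_\rho(C)\,| : C \text{ a spherical cap in }\widetilde{\mathcal S}^{q-2}_\rho\}$. A sequence of nonzero vectors $\{{\bf y}^q\in\widetilde{\mathcal M}^{q-1}_{\le}\}$ ($q$ varying) is APU if $\lim_{q\to\infty}D^{q-2}(\Pi({\bf y}^q))=0$. For a sequence ${\bf x}^q\in\mathbb{R}^q$ with ordered components $x^q_1\le\cdots\le x^q_q$ (not all equal), APU means the same property for its projections ${\bf x}^q-\left(\frac1q\sum_i x_i^q\right){\bf e}^q$ onto $\widetilde{\mathcal M}^{q-1}$. *)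

theory Defs
  imports "HOL-Probability.Probability" "HOL-Combinatorics.Permutations"
begin

text \<open>
  Since the dimension \<open>q\<close> varies, a vector of \<open>\<real>\<^sup>q\<close> is a function on \<open>{1..q}\<close>, extended by
  \<open>undefined\<close> outside this set, that is, an element of \<open>{1..q} \<rightarrow>\<^sub>E UNIV\<close>. In this way equal
  vectors are equal functions, and finite sets of vectors have the right cardinality.
\<close>

definition vecs :: "nat \<Rightarrow> (nat \<Rightarrow> real) set" where
  "vecs q = {1..q} \<rightarrow>\<^sub>E UNIV"

definition inner_q :: "nat \<Rightarrow> (nat \<Rightarrow> real) \<Rightarrow> (nat \<Rightarrow> real) \<Rightarrow> real" where
  "inner_q q v w = (\<Sum>i=1..q. v i * w i)"

definition norm_q :: "nat \<Rightarrow> (nat \<Rightarrow> real) \<Rightarrow> real" where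
  "norm_q q v = sqrt (inner_q q v v)"

definition ones :: "nat \<Rightarrow> nat \<Rightarrow> real" where
  "ones q = (\<lambda>i\<in>{1..q}. 1)"

definition hyp :: "nat \<Rightarrow> (nat \<Rightarrow> real) set" where
  "hyp q = {v \<in> vecs q. inner_q q v (ones q) = 0}"

definition ord_hyp :: "nat \<Rightarrow> (nat \<Rightarrow> real) set" where
  "ord_hyp q = {v \<in> hyp q. \<forall>i\<in>{1..q}. \<forall>j\<in>{1..q}. i \<le> j \<longrightarrow> v i \<le> v j}"

definition hyp_sphere :: "nat \<Rightarrow> real \<Rightarrow> (nat \<Rightarrow> real) set" where
  "hyp_sphere q \<rho> = {v \<in> hyp q. norm_q q v = \<rho>}"

text \<open>The set of all \<open>P y\<close> with \<open>P\<close> a permutation matrix; \<open>(P y)\<^sub>i = y\<^bsub>p i\<^esub>\<close> for a permutation \<open>p\<close>.\<close>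

definition perm_orbit :: "nat \<Rightarrow> (nat \<Rightarrow> real) \<Rightarrow> (nat \<Rightarrow> real) set" where
  "perm_orbit q y = {(\<lambda>i\<in>{1..q}. y (p i)) |p. p permutes {1..q}}"

definition mat_app :: "nat \<Rightarrow> (nat \<Rightarrow> nat \<Rightarrow> real) \<Rightarrow> (nat \<Rightarrow> real) \<Rightarrow> nat \<Rightarrow> real" where
  "mat_app q A v = (\<lambda>i\<in>{1..q}. \<Sum>j=1..q. A i j * v j)"

text \<open>
  The orthogonal \<open>q \<times> q\<close> matrices that leave the hyperplane \<open>hyp q\<close> invariant. Their restrictions
  to \<open>hyp q\<close> are exactly the linear isometries of \<open>hyp q\<close>.
\<close>

definition hyp_rotation :: "nat \<Rightarrow> (nat \<Rightarrow> nat \<Rightarrow> real) \<Rightarrow> bool" where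
  "hyp_rotation q A \<longleftrightarrow>
     (\<forall>i\<in>{1..q}. \<forall>j\<in>{1..q}. (\<Sum>k=1..q. A k i * A k j) = (if i = j then 1 else 0)) \<and>
     (\<forall>v\<in>hyp q. mat_app q A v \<in> hyp q)"

text \<open>
  The Borel sets of \<open>\<real>\<^sup>q\<close> are those of the product measurable space. For \<open>q \<ge> 3\<close> and
  \<open>\<rho> > 0\<close> there is exactly one rotation-invariant Borel probability measure on the sphere, so
  \<open>SOME\<close> picks the uniform distribution.
\<close>

definition rotation_invariant_prob :: "nat \<Rightarrow> real \<Rightarrow> (nat \<Rightarrow> real) measure \<Rightarrow> bool" where
  "rotation_invariant_prob q \<rho> U \<longleftrightarrow>
     prob_space U \<and>
     space U = hyp_sphere q \<rho> \<and>
     sets U = sets (restrict_space (Pi\<^sub>M {1..q} (\<lambda>_. borel)) (hyp_sphere q \<rho>)) \<and>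
     (\<forall>A. hyp_rotation q A \<longrightarrow> distr U U (mat_app q A) = U)"

definition unif_sphere :: "nat \<Rightarrow> real \<Rightarrow> (nat \<Rightarrow> real) measure" where
  "unif_sphere q \<rho> = (SOME U. rotation_invariant_prob q \<rho> U)"

definition cap :: "nat \<Rightarrow> real \<Rightarrow> (nat \<Rightarrow> real) \<Rightarrow> real \<Rightarrow> (nat \<Rightarrow> real) set" where
  "cap q \<rho> w t = {v \<in> hyp_sphere q \<rho>. inner_q q v w > \<rho>\<^sup>2 * t}"

definition caps :: "nat \<Rightarrow> real \<Rightarrow> (nat \<Rightarrow> real) set set" where
  "caps q \<rho> = {cap q \<rho> w t |w t. w \<in> hyp_sphere q \<rho> \<and> -1 \<le> t \<and> t < 1}"

definition cap_discrepancy :: "nat \<Rightarrow> real \<Rightarrow> (nat \<Rightarrow> real) set \<Rightarrow> real" where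
  "cap_discrepancy q \<rho> N =
     (SUP C\<in>caps q \<rho>. \<bar>real (card (N \<inter> C)) / real (card N) - measure (unif_sphere q \<rho>) C\<bar>)"

text \<open>
  \<open>APU_hyp\<close> is meant for sequences of nonzero vectors \<open>y q \<in> ord_hyp q\<close>, and \<open>APU\<close> for sequences of
  nonconstant vectors of \<open>vecs q\<close> with nondecreasing components. These side conditions are
  deliberately not conjuncts, since otherwise the negation of the property could hold for trivial
  reasons; the final lemmas show that the configurations satisfy them for \<open>q \<ge> 3\<close>. The
  terms with \<open>q < 3\<close> do not affect the limit.
\<close>

definition APU_hyp :: "(nat \<Rightarrow> nat \<Rightarrow> real) \<Rightarrow> bool" where
  "APU_hyp y \<longleftrightarrow>
     (\<lambda>q. cap_discrepancy q (norm_q q (y q)) (perm_orbit q (y q))) \<longlonglongrightarrow> 0"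

definition proj_hyp :: "nat \<Rightarrow> (nat \<Rightarrow> real) \<Rightarrow> nat \<Rightarrow> real" where
  "proj_hyp q x = (\<lambda>k\<in>{1..q}. x k - (1 / real q * (\<Sum>i=1..q. x i)) * ones q k)"

definition APU :: "(nat \<Rightarrow> nat \<Rightarrow> real) \<Rightarrow> bool" where
  "APU x \<longleftrightarrow> APU_hyp (\<lambda>q. proj_hyp q (x q))"

definition b_seq :: "nat \<Rightarrow> nat \<Rightarrow> real" where
  "b_seq q k = sqrt (3 * real k * (real q - real k) / (real q * (real q + 1)))"

definition a_hat :: "nat \<Rightarrow> nat \<Rightarrow> real" where
  "a_hat q = (\<lambda>k\<in>{1..q}. b_seq q (k - 1) - b_seq q k)"

definition y_hat :: "nat \<Rightarrow> nat \<Rightarrow> real" where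
  "y_hat q = (\<lambda>k\<in>{1..q}.
     sqrt (real q * ((real q)\<^sup>2 - 1) / 12) * (a_hat q k / norm_q q (a_hat q)))"

definition x_hat :: "nat \<Rightarrow> nat \<Rightarrow> real" where
  "x_hat q = (\<lambda>k\<in>{1..q}. y_hat q k + (real q + 1) / 2 * ones q k)"

lemma b_seq_concave:
  assumes "1 \<le> k" "k < q"
  shows "b_seq q (k - 1) + b_seq q (k + 1) \<le> 2 * b_seq q k"
proof -
  define c where "c = 3 / (real q * (real q + 1))"
  have c: "c \<ge> 0" by (simp add: c_def)
  have b: "b_seq q j = sqrt (c * (real j * (real q - real j)))" for j
    by (simp add: b_seq_def c_def field_simps)
  define r where "r = real k"
  define n where "n = real q"
  have rn: "1 \<le> r" "r + 1 \<le> n" using assms by (auto simp: r_def n_def)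
  define s where "s = sqrt (c * ((r - 1) * (n - r + 1)))"
  define t where "t = sqrt (c * ((r + 1) * (n - r - 1)))"
  have s2: "s\<^sup>2 = c * ((r - 1) * (n - r + 1))" and t2: "t\<^sup>2 = c * ((r + 1) * (n - r - 1))"
    unfolding s_def t_def using c rn by simp_all
  have "(s + t)\<^sup>2 \<le> 2 * (s\<^sup>2 + t\<^sup>2)"
    using zero_le_power2[of "s - t"] by (simp add: power2_eq_square algebra_simps)
  also have "\<dots> = 4 * (c * (r * (n - r))) - 4 * c"
    unfolding s2 t2 by (simp add: algebra_simps)
  also have "\<dots> \<le> 4 * (c * (r * (n - r)))" using c by simp
  finally have "s + t \<le> sqrt (4 * (c * (r * (n - r))))"
    by (rule real_le_rsqrt)
  also have "\<dots> = 2 * sqrt (c * (r * (n - r)))"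
    by (simp add: real_sqrt_mult)
  finally show ?thesis
    using assms by (simp add: b s_def t_def r_def n_def of_nat_diff algebra_simps)
qed

lemma a_hat_mono:
  assumes "1 \<le> i" "i \<le> j" "j \<le> q"
  shows "a_hat q i \<le> a_hat q j"
  using assms(2,1,3)
proof (induction j rule: dec_induct)
  case (step n)
  have "a_hat q n \<le> a_hat q (Suc n)"
    using b_seq_concave[of n q] step by (simp add: a_hat_def)
  then show ?case using step by simp
qed simp

lemma norm_a_hat_pos:
  assumes "q \<ge> 3"
  shows "norm_q q (a_hat q) > 0"
proof -
  have "b_seq q 1 > 0" "b_seq q 0 = 0" using assms by (auto simp: b_seq_def)
  then have "a_hat q 1 \<noteq> 0" using assms by (simp add: a_hat_def)
  then have "0 < a_hat q 1 * a_hat q 1" using not_real_square_gt_zero by blast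
  also have "\<dots> \<le> (\<Sum>i=1..q. a_hat q i * a_hat q i)"
    using assms by (intro member_le_sum) auto
  finally show ?thesis by (simp add: norm_q_def inner_q_def)
qed

lemma sum_a_hat: "(\<Sum>i=1..q. a_hat q i) = 0"
proof -
  have "(\<Sum>i=1..q. a_hat q i) = (\<Sum>i=1..q. b_seq q (i - 1) - b_seq q i)"
    by (intro sum.cong) (auto simp: a_hat_def)
  also have "\<dots> = (\<Sum>i<q. b_seq q i - b_seq q (Suc i))"
    by (rule sum.reindex_bij_witness[of _ Suc "\<lambda>i. i - 1"]) auto
  also have "\<dots> = b_seq q 0 - b_seq q q"
    by (rule sum_lessThan_telescope')
  finally show ?thesis by (simp add: b_seq_def)
qed

lemma y_hat_ord_hyp: "y_hat q \<in> ord_hyp q"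
proof -
  define c where "c = sqrt (real q * ((real q)\<^sup>2 - 1) / 12) / norm_q q (a_hat q)"
  have "real q * ((real q)\<^sup>2 - 1) \<ge> 0" by (cases q) (auto simp: power2_eq_square algebra_simps)
  then have c: "c \<ge> 0"
    by (simp add: c_def norm_q_def inner_q_def sum_nonneg)
  have y: "y_hat q = (\<lambda>k\<in>{1..q}. c * a_hat q k)"
    by (simp add: y_hat_def c_def)
  have "inner_q q (y_hat q) (ones q) = (\<Sum>i=1..q. c * a_hat q i)"
    by (simp add: inner_q_def y ones_def)
  also have "\<dots> = 0" by (simp only: sum_a_hat flip: sum_distrib_left)
  finally show ?thesis
    using c by (auto simp: ord_hyp_def hyp_def vecs_def y intro!: mult_left_mono a_hat_mono)
qed

lemma norm_y_hat:
  assumes "q \<ge> 3"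
  shows "norm_q q (y_hat q) = sqrt (real q * ((real q)\<^sup>2 - 1) / 12)"
proof -
  define d where "d = sqrt (real q * ((real q)\<^sup>2 - 1) / 12)"
  define m where "m = norm_q q (a_hat q)"
  have m: "m > 0" using norm_a_hat_pos[OF assms] by (simp add: m_def)
  have d: "d \<ge> 0" using assms by (simp add: d_def)
  have y: "y_hat q = (\<lambda>k\<in>{1..q}. d * (a_hat q k / m))"
    by (simp only: y_hat_def d_def m_def)
  have "inner_q q (y_hat q) (y_hat q) = (\<Sum>i=1..q. (d / m)\<^sup>2 * (a_hat q i * a_hat q i))"
    unfolding inner_q_def
    by (intro sum.cong) (auto simp: y power2_eq_square)
  also have "\<dots> = (d / m)\<^sup>2 * m\<^sup>2"
    by (simp add: m_def norm_q_def inner_q_def sum_nonneg flip: sum_distrib_left)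
  also have "\<dots> = d\<^sup>2" using m by (simp add: power_divide)
  finally show ?thesis using d by (simp add: norm_q_def d_def[symmetric])
qed

lemma x_hat_mono: "1 \<le> i \<Longrightarrow> i \<le> j \<Longrightarrow> j \<le> q \<Longrightarrow> x_hat q i \<le> x_hat q j"
  using y_hat_ord_hyp[of q] by (simp add: x_hat_def ones_def ord_hyp_def)

lemma proj_x_hat: "proj_hyp q (x_hat q) = y_hat q"
proof -
  have 0: "(\<Sum>i=1..q. y_hat q i) = 0"
    using y_hat_ord_hyp[of q] by (simp add: ord_hyp_def hyp_def inner_q_def ones_def)
  have "(\<Sum>i=1..q. x_hat q i) = (\<Sum>i=1..q. y_hat q i + (real q + 1) / 2)"
    by (intro sum.cong) (auto simp: x_hat_def ones_def)
  also have "\<dots> = real q * ((real q + 1) / 2)" by (simp only: sum.distrib 0) simp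
  finally have s: "(\<Sum>i=1..q. x_hat q i) = real q * ((real q + 1) / 2)" .
  show ?thesis
    unfolding proj_hyp_def s by (rule ext) (auto simp: x_hat_def ones_def y_hat_def restrict_def)
qed

end

theory Submission
  imports Defs
begin

text \<open>
  Write \<open>y\<close> for the maximal configuration in dimension \<open>q\<close>, \<open>\<rho>\<close> for its norm, and consider the
  cap of all \<open>v\<close> on the sphere with \<open>v\<^sub>1 - v\<^sub>2 > \<rho> / sqrt (2 q)\<close>, centred at a multiple of
  \<open>e\<^sub>1 - e\<^sub>2\<close>.

  Its uniform measure is bounded away from zero: rotation invariance alone determines the
  second moment of \<open>v\<^sub>1 - v\<^sub>2\<close> and bounds the fourth moment by a multiple of \<open>\<rho>\<^sup>4 / q\<^sup>2\<close>, so an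
  argument of Paley-Zygmund type applies.

  The proportion of permutations of \<open>y\<close> in the cap tends to zero. It is at most of the order of
  \<open>\<parallel>y\<parallel>\<^sub>1 / (sqrt q \<parallel>y\<parallel>)\<close> by Markov's inequality, averaged over all pairs of coordinates. The
  1-norm of the increments of \<open>b\<close> is just \<open>2 b\<^bsub>q/2\<^esub>\<close>, but because of the steep increments near
  the ends of the range, \<open>sqrt q\<close> times their Euclidean norm is larger by a factor \<open>sqrt (ln q)\<close>.

  The uniform measure is only given by a choice operator, so its existence has to be proved: it is
  obtained by projecting the unit ball of \<open>\<real>\<^sup>q\<close> to the hyperplane and then radially to the sphere.
\<close>

section \<open>Orthogonal maps\<close>

lemma vecs_eqI:
  assumes "v \<in> vecs q" "w \<in> vecs q" "\<And>i. i \<in> {1..q} \<Longrightarrow> v i = w i"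
  shows "v = w"
  using assms unfolding vecs_def by (rule PiE_ext)

lemma mat_app_vecs [simp]: "mat_app q A v \<in> vecs q"
  by (auto simp: mat_app_def vecs_def)

lemma inner_q_commute: "inner_q q v w = inner_q q w v"
  by (simp add: inner_q_def mult.commute)

lemma inner_q_nonneg: "inner_q q v v \<ge> 0"
  by (simp add: inner_q_def sum_nonneg)

lemma norm_q_square: "(norm_q q v)\<^sup>2 = inner_q q v v"
  by (simp add: norm_q_def inner_q_nonneg)

lemma hyp_iff: "v \<in> hyp q \<longleftrightarrow> v \<in> vecs q \<and> (\<Sum>i=1..q. v i) = 0"
  by (simp add: hyp_def inner_q_def ones_def)

lemma hyp_sphere_iff:
  assumes "\<rho> \<ge> 0"
  shows "v \<in> hyp_sphere q \<rho> \<longleftrightarrow> v \<in> hyp q \<and> inner_q q v v = \<rho>\<^sup>2"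
  using assms by (auto simp: hyp_sphere_def norm_q_def real_sqrt_eq_iff inner_q_nonneg)

text \<open>The half of \<open>hyp_rotation\<close> saying \<open>A^T A = 1\<close>, isolated
  because for \<open>q > 0\<close> it alone makes \<open>A\<close> preserve Lebesgue
  measure.\<close>

definition orthogonal_q :: "nat \<Rightarrow> (nat \<Rightarrow> nat \<Rightarrow> real) \<Rightarrow> bool" where
  "orthogonal_q q A \<longleftrightarrow>
     (\<forall>i\<in>{1..q}. \<forall>j\<in>{1..q}. (\<Sum>k=1..q. A k i * A k j) = (if i = j then 1 else 0))"

lemma hyp_rotation_orthogonal: "hyp_rotation q A \<Longrightarrow> orthogonal_q q A"
  by (simp add: hyp_rotation_def orthogonal_q_def)

text \<open>
  With \<open>Q = A A\<^sup>T\<close>, the squared Frobenius norm of \<open>Q - 1\<close> is \<open>tr Q\<^sup>2 - 2 tr Q + q\<close>, and both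
  traces equal \<open>q\<close> when \<open>A\<^sup>T A = 1\<close>.
\<close>

lemma orthogonal_q_transpose:
  assumes "orthogonal_q q A"
  shows "orthogonal_q q (\<lambda>i j. A j i)"
proof -
  define Q where "Q i j = (\<Sum>k=1..q. A i k * A j k)" for i j
  define \<delta> :: "nat \<Rightarrow> nat \<Rightarrow> real" where "\<delta> i j = (if i = j then 1 else 0)" for i j
  have orth: "(\<Sum>k=1..q. A k i * A k j) = \<delta> i j" if "i \<in> {1..q}" "j \<in> {1..q}" for i j
    using assms that unfolding orthogonal_q_def \<delta>_def by blast
  have "(\<Sum>i=1..q. \<Sum>j=1..q. Q i j * Q i j)
      = (\<Sum>i=1..q. \<Sum>j=1..q. \<Sum>k=1..q. \<Sum>l=1..q. (A i k * A j k) * (A i l * A j l))"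
    unfolding Q_def sum_product ..
  also have "\<dots> = (\<Sum>i=1..q. \<Sum>k=1..q. \<Sum>l=1..q. \<Sum>j=1..q. (A i k * A j k) * (A i l * A j l))"
    by (rule sum.cong[OF refl], rule trans[OF sum.swap], rule sum.cong[OF refl], rule sum.swap)
  also have "\<dots> = (\<Sum>k=1..q. \<Sum>l=1..q. \<Sum>i=1..q. \<Sum>j=1..q. (A i k * A j k) * (A i l * A j l))"
    by (rule trans[OF sum.swap], rule sum.cong[OF refl], rule sum.swap)
  also have "\<dots> = (\<Sum>k=1..q. \<Sum>l=1..q. (\<Sum>i=1..q. A i k * A i l) * (\<Sum>j=1..q. A j k * A j l))"
    unfolding sum_product by (intro sum.cong refl) (simp add: mult_ac)
  also have "\<dots> = (\<Sum>k=1..q. \<Sum>l=1..q. \<delta> k l)"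
    by (intro sum.cong refl) (subst (1 2) orth, auto simp: \<delta>_def)
  also have "\<dots> = real q" by (simp add: \<delta>_def)
  finally have QQ: "(\<Sum>i=1..q. \<Sum>j=1..q. Q i j * Q i j) = real q" .
  have "(\<Sum>i=1..q. Q i i) = (\<Sum>k=1..q. \<Sum>i=1..q. A i k * A i k)"
    unfolding Q_def by (rule sum.swap)
  also have "\<dots> = (\<Sum>k=1..q. 1)"
    by (intro sum.cong refl) (subst orth, auto simp: \<delta>_def)
  also have "\<dots> = real q" by simp
  finally have Q: "(\<Sum>i=1..q. Q i i) = real q" .
  have "(\<Sum>i=1..q. \<Sum>j=1..q. (Q i j - \<delta> i j)\<^sup>2)
      = (\<Sum>i=1..q. \<Sum>j=1..q. Q i j * Q i j - 2 * (if i = j then Q i i else 0) + \<delta> i j)"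
    by (intro sum.cong refl) (auto simp: \<delta>_def power2_eq_square algebra_simps)
  also have "\<dots> = (\<Sum>i=1..q. \<Sum>j=1..q. Q i j * Q i j) - 2 * (\<Sum>i=1..q. Q i i) + real q"
    unfolding sum.distrib sum_subtractf sum_distrib_left[symmetric] by (simp add: \<delta>_def)
  also have "\<dots> = 0" unfolding Q QQ by simp
  finally have "(\<Sum>i=1..q. \<Sum>j=1..q. (Q i j - \<delta> i j)\<^sup>2) = 0" .
  then have "\<forall>i\<in>{1..q}. (\<Sum>j=1..q. (Q i j - \<delta> i j)\<^sup>2) = 0"
    by (subst (asm) sum_nonneg_eq_0_iff) (auto intro: sum_nonneg)
  then have "\<forall>i\<in>{1..q}. \<forall>j\<in>{1..q}. (Q i j - \<delta> i j)\<^sup>2 = 0"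
    by (subst (asm) sum_nonneg_eq_0_iff) auto
  then show ?thesis by (simp add: orthogonal_q_def Q_def \<delta>_def)
qed

lemma inner_q_mat_app:
  "inner_q q (mat_app q A v) w = inner_q q v (mat_app q (\<lambda>i j. A j i) w)"
proof -
  have "inner_q q (mat_app q A v) w = (\<Sum>i=1..q. \<Sum>j=1..q. A i j * v j * w i)"
    by (simp add: inner_q_def mat_app_def sum_distrib_right)
  also have "\<dots> = (\<Sum>j=1..q. \<Sum>i=1..q. A i j * v j * w i)" by (rule sum.swap)
  also have "\<dots> = inner_q q v (mat_app q (\<lambda>i j. A j i) w)"
    by (simp add: inner_q_def mat_app_def sum_distrib_left mult_ac)
  finally show ?thesis .
qed

lemma mat_app_transpose_cancel:
  assumes "orthogonal_q q A" "v \<in> vecs q"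
  shows "mat_app q (\<lambda>i j. A j i) (mat_app q A v) = v"
proof (rule vecs_eqI)
  fix i assume i: "i \<in> {1..q}"
  have "mat_app q (\<lambda>i j. A j i) (mat_app q A v) i = (\<Sum>j=1..q. \<Sum>k=1..q. A j i * A j k * v k)"
    using i by (simp add: mat_app_def sum_distrib_left mult_ac)
  also have "\<dots> = (\<Sum>k=1..q. (\<Sum>j=1..q. A j i * A j k) * v k)"
    by (subst sum.swap) (simp add: sum_distrib_right)
  also have "\<dots> = (\<Sum>k=1..q. if i = k then v k else 0)"
    using assms(1) i by (intro sum.cong) (auto simp: orthogonal_q_def)
  also have "\<dots> = v i" using i by simp
  finally show "mat_app q (\<lambda>i j. A j i) (mat_app q A v) i = v i" .
qed (use assms in auto)

lemma inner_q_orthogonal: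
  assumes "orthogonal_q q A" "v \<in> vecs q"
  shows "inner_q q (mat_app q A v) (mat_app q A v) = inner_q q v v"
  using assms by (simp add: inner_q_mat_app mat_app_transpose_cancel)

section \<open>Addition and scaling of vectors\<close>

definition vec_add :: "nat \<Rightarrow> (nat \<Rightarrow> real) \<Rightarrow> (nat \<Rightarrow> real) \<Rightarrow> nat \<Rightarrow> real" where
  "vec_add q v w = (\<lambda>i\<in>{1..q}. v i + w i)"

definition vec_scale :: "nat \<Rightarrow> real \<Rightarrow> (nat \<Rightarrow> real) \<Rightarrow> nat \<Rightarrow> real" where
  "vec_scale q c v = (\<lambda>i\<in>{1..q}. c * v i)"

lemma vec_add_vecs [simp]: "vec_add q v w \<in> vecs q"
  by (auto simp: vec_add_def vecs_def)

lemma vec_scale_vecs [simp]: "vec_scale q c v \<in> vecs q"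
  by (auto simp: vec_scale_def vecs_def)

lemma mat_app_vec_add: "mat_app q A (vec_add q v w) = vec_add q (mat_app q A v) (mat_app q A w)"
  by (rule vecs_eqI[OF mat_app_vecs vec_add_vecs]) (simp add: mat_app_def vec_add_def sum.distrib algebra_simps)

lemma mat_app_vec_scale: "mat_app q A (vec_scale q c v) = vec_scale q c (mat_app q A v)"
  by (rule vecs_eqI[OF mat_app_vecs vec_scale_vecs]) (simp add: mat_app_def vec_scale_def sum_distrib_left mult_ac)

lemma inner_q_vec_scale: "inner_q q (vec_scale q c v) (vec_scale q c v) = c\<^sup>2 * inner_q q v v"
  by (simp add: inner_q_def vec_scale_def sum_distrib_left power2_eq_square mult_ac)

section \<open>Invariance of Lebesgue measure\<close>

text \<open>A product over the index set is used because the dimension varies. It has the measurable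
  sets that \<open>rotation_invariant_prob\<close> restricts to the sphere.\<close>

definition lebesgue_q :: "nat \<Rightarrow> (nat \<Rightarrow> real) measure" where
  "lebesgue_q q = Pi\<^sub>M {1..q} (\<lambda>_. lborel)"

lemma space_lebesgue_q [simp]: "space (lebesgue_q q) = vecs q"
  by (simp add: lebesgue_q_def space_PiM vecs_def)

lemma sets_lebesgue_q: "sets (lebesgue_q q) = sets (Pi\<^sub>M {1..q} (\<lambda>_. borel))"
  unfolding lebesgue_q_def by (rule sets_PiM_cong) simp_all

lemma measurable_lebesgue_q_component [measurable]:
  "i \<in> {1..q} \<Longrightarrow> (\<lambda>v. v i) \<in> borel_measurable (lebesgue_q q)"
  using measurable_component_singleton[of i "{1..q}" "\<lambda>_. lborel :: real measure"]
  by (simp add: lebesgue_q_def)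

text \<open>A function with values in \<open>vecs q\<close> coincides with its own restriction to
  \<open>{1..q}\<close>, so measurability can be checked one component at a time.\<close>

lemma measurable_into_lebesgue_q:
  assumes "\<And>i. i \<in> {1..q} \<Longrightarrow> (\<lambda>x. f x i) \<in> borel_measurable M"
    "\<And>x. x \<in> space M \<Longrightarrow> f x \<in> vecs q"
  shows "f \<in> measurable M (lebesgue_q q)"
proof -
  have "(\<lambda>x. \<lambda>i\<in>{1..q}. f x i) \<in> measurable M (lebesgue_q q)"
    unfolding lebesgue_q_def by (rule measurable_restrict) (use assms(1) in simp)
  moreover have "(\<lambda>i\<in>{1..q}. f x i) = f x" if "x \<in> space M" for x
    using assms(2)[OF that] by (intro vecs_eqI[of _ q]) (auto simp: vecs_def)
  ultimately show ?thesis by (subst measurable_cong) auto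
qed

lemma measurable_inner_q:
  assumes [measurable]: "f \<in> measurable M (lebesgue_q q)" "g \<in> measurable M (lebesgue_q q)"
  shows "(\<lambda>x. inner_q q (f x) (g x)) \<in> borel_measurable M"
proof -
  have [measurable]: "(\<lambda>x. f x i) \<in> borel_measurable M" "(\<lambda>x. g x i) \<in> borel_measurable M"
    if "i \<in> {1..q}" for i
    using measurable_compose[OF assms(1) measurable_lebesgue_q_component[OF that]]
      measurable_compose[OF assms(2) measurable_lebesgue_q_component[OF that]] by auto
  show ?thesis unfolding inner_q_def by (intro borel_measurable_sum borel_measurable_times) auto
qed

lemma measurable_mat_app [measurable]: "mat_app q A \<in> measurable (lebesgue_q q) (lebesgue_q q)"
proof (rule measurable_into_lebesgue_q)
  fix i assume "i \<in> {1..q}"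
  then show "(\<lambda>v. mat_app q A v i) \<in> borel_measurable (lebesgue_q q)"
    by (auto simp: mat_app_def intro!: borel_measurable_sum borel_measurable_times)
qed simp

lemma measurable_vec_scale [measurable]:
  "vec_scale q c \<in> measurable (lebesgue_q q) (lebesgue_q q)"
proof (rule measurable_into_lebesgue_q)
  fix i assume "i \<in> {1..q}"
  then show "(\<lambda>v. vec_scale q c v i) \<in> borel_measurable (lebesgue_q q)"
    by (simp add: vec_scale_def)
qed simp

lemma measurable_translate [measurable]:
  "vec_add q a \<in> measurable (lebesgue_q q) (lebesgue_q q)"
proof (rule measurable_into_lebesgue_q)
  fix i assume "i \<in> {1..q}"
  then show "(\<lambda>v. vec_add q a v i) \<in> borel_measurable (lebesgue_q q)"
    by (simp add: vec_add_def)
qed simp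

lemma measurable_vec_add:
  assumes "f \<in> measurable M (lebesgue_q q)" "g \<in> measurable M (lebesgue_q q)"
  shows "(\<lambda>x. vec_add q (f x) (g x)) \<in> measurable M (lebesgue_q q)"
proof (rule measurable_into_lebesgue_q)
  fix i assume i: "i \<in> {1..q}"
  show "(\<lambda>x. vec_add q (f x) (g x) i) \<in> borel_measurable M"
    using measurable_compose[OF assms(1) measurable_lebesgue_q_component[OF i]]
      measurable_compose[OF assms(2) measurable_lebesgue_q_component[OF i]] i
    by (simp add: vec_add_def)
qed simp

lemma measurable_vec_add_const [measurable]:
  "a \<in> vecs q \<Longrightarrow> (\<lambda>v. vec_add q v a) \<in> measurable (lebesgue_q q) (lebesgue_q q)"
  by (intro measurable_vec_add measurable_ident measurable_const) auto

lemma sigma_finite_lebesgue_q: "sigma_finite_measure (lebesgue_q q)"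
proof -
  interpret product_sigma_finite "\<lambda>_::nat. lborel :: real measure" by standard
  show ?thesis unfolding lebesgue_q_def by (rule sigma_finite) simp
qed

lemma emeasure_lebesgue_q_box:
  assumes "\<And>i. i \<in> {1..q} \<Longrightarrow> B i \<in> sets borel"
  shows "emeasure (lebesgue_q q) (Pi\<^sub>E {1..q} B) = (\<Prod>i=1..q. emeasure lborel (B i))"
proof -
  interpret product_sigma_finite "\<lambda>_::nat. lborel :: real measure" by standard
  show ?thesis unfolding lebesgue_q_def by (rule emeasure_PiM) (use assms in auto)
qed

lemma box_in_sets_lebesgue_q:
  assumes "\<And>i. i \<in> {1..q} \<Longrightarrow> B i \<in> sets borel"
  shows "Pi\<^sub>E {1..q} B \<in> sets (lebesgue_q q)"
  unfolding lebesgue_q_def by (rule sets_PiM_I_finite) (use assms in auto)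

text \<open>A product measure is determined by its values on boxes, and on a box the claim splits
  into translation invariance of \<open>lborel\<close> in each coordinate.\<close>

lemma distr_lebesgue_q_translate:
  "distr (lebesgue_q q) (lebesgue_q q) (vec_add q a) = lebesgue_q q"
proof -
  interpret product_sigma_finite "\<lambda>_::nat. lborel :: real measure" by standard
  have "distr (lebesgue_q q) (lebesgue_q q) (vec_add q a) = Pi\<^sub>M {1..q} (\<lambda>_. lborel)"
  proof (rule PiM_eqI)
    fix B :: "nat \<Rightarrow> real set" assume B: "\<And>i. i \<in> {1..q} \<Longrightarrow> B i \<in> sets lborel"
    have "emeasure (distr (lebesgue_q q) (lebesgue_q q) (vec_add q a)) (Pi\<^sub>E {1..q} B)
        = emeasure (lebesgue_q q) (vec_add q a -` Pi\<^sub>E {1..q} B \<inter> vecs q)"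
      using box_in_sets_lebesgue_q[of q B] B by (subst emeasure_distr) simp_all
    also have "vec_add q a -` Pi\<^sub>E {1..q} B \<inter> vecs q = Pi\<^sub>E {1..q} (\<lambda>i. (+) (a i) -` B i)"
      by (auto simp: vec_add_def vecs_def PiE_iff)
    also have "emeasure (lebesgue_q q) \<dots> = (\<Prod>i=1..q. emeasure lborel ((+) (a i) -` B i))"
      using B by (intro emeasure_lebesgue_q_box)
        (auto intro!: measurable_sets_borel[where M = borel])
    also have "\<dots> = (\<Prod>i=1..q. emeasure lborel (B i))"
    proof (intro prod.cong refl)
      fix i assume "i \<in> {1..q}"
      then have "emeasure (distr lborel borel ((+) (a i))) (B i) = emeasure lborel ((+) (a i) -` B i)"
        using B by (subst emeasure_distr) auto
      then show "emeasure lborel ((+) (a i) -` B i) = emeasure lborel (B i)"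
        by (simp add: lborel_distr_plus)
    qed
    finally show "emeasure (distr (lebesgue_q q) (lebesgue_q q) (vec_add q a)) (Pi\<^sub>E {1..q} B)
      = (\<Prod>i=1..q. emeasure lborel (B i))" .
  qed (simp_all add: lebesgue_q_def)
  then show ?thesis by (simp only: lebesgue_q_def[symmetric])
qed

lemma nn_integral_lebesgue_q_translate:
  assumes [measurable]: "f \<in> borel_measurable (lebesgue_q q)"
  shows "(\<integral>\<^sup>+v. f (vec_add q a v) \<partial>lebesgue_q q) = (\<integral>\<^sup>+v. f v \<partial>lebesgue_q q)"
proof -
  have "(\<integral>\<^sup>+v. f v \<partial>distr (lebesgue_q q) (lebesgue_q q) (vec_add q a))
      = (\<integral>\<^sup>+v. f (vec_add q a v) \<partial>lebesgue_q q)"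
    by (rule nn_integral_distr) auto
  then show ?thesis by (simp add: distr_lebesgue_q_translate)
qed

section \<open>The unit ball: positive and finite volume\<close>

definition unit_ball_q :: "nat \<Rightarrow> (nat \<Rightarrow> real) set" where
  "unit_ball_q q = {v \<in> vecs q. inner_q q v v \<le> 1}"

lemma unit_ball_q_sets [measurable]: "unit_ball_q q \<in> sets (lebesgue_q q)"
proof -
  have [measurable]: "(\<lambda>v. inner_q q v v) \<in> borel_measurable (lebesgue_q q)"
    by (rule measurable_inner_q) auto
  have "{v \<in> space (lebesgue_q q). inner_q q v v \<le> 1} \<in> sets (lebesgue_q q)" by measurable
  then show ?thesis by (simp add: unit_ball_q_def)
qed

text \<open>Since \<open>1 / q\<close> is at most 1, each of the \<open>q\<close> squared
  coordinates is at most \<open>1 / q\<close>. The box bounds the volume of the ball from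
  below.\<close>

lemma small_box_subset_unit_ball:
  "Pi\<^sub>E {1..q} (\<lambda>_. {-1 / real q..1 / real q}) \<subseteq> unit_ball_q q"
proof
  fix v assume v: "v \<in> Pi\<^sub>E {1..q} (\<lambda>_. {-1 / real q..1 / real q})"
  have "inner_q q v v \<le> (\<Sum>i=1..q. 1 / real q)"
    unfolding inner_q_def
  proof (rule sum_mono)
    fix i assume i: "i \<in> {1..q}"
    then have "\<bar>v i\<bar> \<le> 1 / real q" using PiE_mem[OF v i] by (simp add: abs_le_iff)
    moreover have "1 / real q \<le> 1" using i by simp
    ultimately have "\<bar>v i\<bar> * \<bar>v i\<bar> \<le> 1 / real q * 1" by (intro mult_mono) auto
    then show "v i * v i \<le> 1 / real q" by simp
  qed
  also have "\<dots> \<le> 1" by simp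
  finally show "v \<in> unit_ball_q q" using v by (auto simp: unit_ball_q_def vecs_def)
qed

lemma unit_ball_subset_box: "unit_ball_q q \<subseteq> Pi\<^sub>E {1..q} (\<lambda>_. {-1..1})"
proof
  fix v assume v: "v \<in> unit_ball_q q"
  have "v i \<in> {-1..1}" if "i \<in> {1..q}" for i
  proof -
    have "v i * v i \<le> inner_q q v v" unfolding inner_q_def
      by (rule member_le_sum) (use that in auto)
    also have "\<dots> \<le> 1" using v by (simp add: unit_ball_q_def)
    finally show ?thesis using abs_square_le_1[of "v i"]
      by (simp add: power2_eq_square abs_le_iff)
  qed
  then show "v \<in> Pi\<^sub>E {1..q} (\<lambda>_. {-1..1})"
    using v by (auto simp: unit_ball_q_def vecs_def)
qed

lemma emeasure_unit_ball_q_finite: "emeasure (lebesgue_q q) (unit_ball_q q) < \<infinity>"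
proof -
  have "emeasure (lebesgue_q q) (unit_ball_q q)
      \<le> emeasure (lebesgue_q q) (Pi\<^sub>E {1..q} (\<lambda>_. {-1..1}))"
    by (intro emeasure_mono unit_ball_subset_box box_in_sets_lebesgue_q) auto
  also have "\<dots> = (\<Prod>i=1..q. ennreal 2)"
    by (subst emeasure_lebesgue_q_box) simp_all
  also have "\<dots> = ennreal (\<Prod>i=1..q. 2)" by (rule prod_ennreal) simp
  also have "\<dots> < \<infinity>" by (rule ennreal_less_top[folded infinity_ennreal_def])
  finally show ?thesis .
qed

lemma emeasure_unit_ball_q_pos:
  assumes "q > 0"
  shows "emeasure (lebesgue_q q) (unit_ball_q q) > 0"
proof -
  have "0 < ennreal (\<Prod>i=1..q. 1 / real q - (-1 / real q))"
    using assms by (subst ennreal_less_zero_iff) (intro prod_pos, simp)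
  also have "\<dots> = (\<Prod>i=1..q. emeasure lborel {-1 / real q..1 / real q})"
    by (subst prod_ennreal[symmetric]) simp_all
  also have "\<dots> = emeasure (lebesgue_q q) (Pi\<^sub>E {1..q} (\<lambda>_. {-1 / real q..1 / real q}))"
    by (subst emeasure_lebesgue_q_box) auto
  also have "\<dots> \<le> emeasure (lebesgue_q q) (unit_ball_q q)"
    by (intro emeasure_mono small_box_subset_unit_ball unit_ball_q_sets)
  finally show ?thesis .
qed

text \<open>
  The integral of \<open>1\<^sub>B(x) 1\<^sub>F(x + A y)\<close> over \<open>x\<close> and \<open>y\<close>, where \<open>B\<close> is the unit ball, is evaluated
  in both orders. Translation invariance in \<open>y\<close> gives \<open>\<lambda>(B) \<lambda>(A\<^sup>-\<^sup>1 F)\<close>, translation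
  invariance in \<open>x\<close> and then in \<open>y\<close> gives \<open>\<lambda>(F) \<lambda>(B)\<close>.
\<close>

lemma emeasure_lebesgue_q_orthogonal:
  assumes A: "orthogonal_q q A" and q: "q > 0" and F [measurable]: "F \<in> sets (lebesgue_q q)"
  shows "emeasure (lebesgue_q q) (mat_app q A -` F \<inter> vecs q) = emeasure (lebesgue_q q) F"
proof -
  let ?L = "lebesgue_q q" and ?B = "unit_ball_q q" and ?T = "mat_app q (\<lambda>i j. A j i)"
  define neg where "neg = vec_scale q (-1)"
  interpret L: sigma_finite_measure ?L by (rule sigma_finite_lebesgue_q)
  interpret pair_sigma_finite ?L ?L by standard
  have At: "orthogonal_q q (\<lambda>i j. A j i)" by (rule orthogonal_q_transpose[OF A])
  have AT: "mat_app q A (?T x) = x" if "x \<in> vecs q" for x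
    using mat_app_transpose_cancel[OF At that] by simp
  have negm [measurable]: "neg \<in> measurable ?L ?L"
    unfolding neg_def by measurable
  have sub [measurable]: "(\<lambda>(x, y). vec_add q x (neg (mat_app q A y))) \<in> measurable (?L \<Otimes>\<^sub>M ?L) ?L"
    and add [measurable]: "(\<lambda>(x, y). vec_add q x (mat_app q A y)) \<in> measurable (?L \<Otimes>\<^sub>M ?L) ?L"
    unfolding case_prod_beta by (intro measurable_vec_add; measurable)+
  have "mat_app q A -` F \<inter> space ?L \<in> sets ?L" by measurable
  then have "emeasure ?L (mat_app q A -` F \<inter> vecs q)
      = (\<integral>\<^sup>+y. indicator (mat_app q A -` F \<inter> vecs q) y \<partial>?L)" by simp
  also have "\<dots> = (\<integral>\<^sup>+y. indicator F (mat_app q A y) \<partial>?L)"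
    by (rule nn_integral_cong) (simp add: indicator_def)
  finally have "emeasure ?L ?B * emeasure ?L (mat_app q A -` F \<inter> vecs q)
      = (\<integral>\<^sup>+x. indicator ?B x * (\<integral>\<^sup>+y. indicator F (mat_app q A y) \<partial>?L) \<partial>?L)"
    by (subst nn_integral_multc) auto
  also have "\<dots> = (\<integral>\<^sup>+x. (\<integral>\<^sup>+y. indicator ?B x * indicator F (vec_add q x (mat_app q A y)) \<partial>?L) \<partial>?L)"
  proof (rule nn_integral_cong)
    fix x assume "x \<in> space ?L"
    then have x: "x \<in> vecs q" by simp
    \<comment> \<open>Shifting \<open>y\<close> by \<open>?T x\<close> adds
      \<open>A A^T x = x\<close> to \<open>A y\<close>.\<close>
    have "(\<integral>\<^sup>+y. indicator F (mat_app q A y) \<partial>?L)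
        = (\<integral>\<^sup>+y. indicator F (mat_app q A (vec_add q (?T x) y)) \<partial>?L)"
      by (rule nn_integral_lebesgue_q_translate[symmetric]) measurable
    also have "\<dots> = (\<integral>\<^sup>+y. indicator F (vec_add q x (mat_app q A y)) \<partial>?L)"
      by (simp add: mat_app_vec_add AT[OF x])
    finally show "indicator ?B x * (\<integral>\<^sup>+y. indicator F (mat_app q A y) \<partial>?L)
        = (\<integral>\<^sup>+y. indicator ?B x * indicator F (vec_add q x (mat_app q A y)) \<partial>?L)"
      by (subst nn_integral_cmult) measurable
  qed
  also have "\<dots> = (\<integral>\<^sup>+y. (\<integral>\<^sup>+x. indicator ?B x * indicator F (vec_add q x (mat_app q A y)) \<partial>?L) \<partial>?L)"
    by (rule Fubini'[symmetric]) measurable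
  also have "\<dots> = (\<integral>\<^sup>+y. (\<integral>\<^sup>+x. indicator ?B (vec_add q x (neg (mat_app q A y))) * indicator F x \<partial>?L) \<partial>?L)"
  proof (rule nn_integral_cong)
    fix y assume "y \<in> space ?L"
    define z where "z = mat_app q A y"
    have [measurable]: "neg z \<in> vecs q" by (simp add: neg_def)
    have "(\<integral>\<^sup>+x. indicator ?B (vec_add q x (neg z)) * indicator F x \<partial>?L)
        = (\<integral>\<^sup>+x. indicator ?B (vec_add q (vec_add q z x) (neg z)) * indicator F (vec_add q z x) \<partial>?L)"
      by (rule nn_integral_lebesgue_q_translate[symmetric, where a = z]) measurable
    also have "\<dots> = (\<integral>\<^sup>+x. indicator ?B x * indicator F (vec_add q x z) \<partial>?L)"
    proof (intro nn_integral_cong)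
      fix x assume "x \<in> space ?L"
      then have "vec_add q (vec_add q z x) (neg z) = x"
        by (intro vecs_eqI[OF vec_add_vecs]) (auto simp: vec_add_def neg_def vec_scale_def)
      moreover have "vec_add q z x = vec_add q x z" by (auto simp: vec_add_def add.commute)
      ultimately show "indicator ?B (vec_add q (vec_add q z x) (neg z)) * indicator F (vec_add q z x)
        = (indicator ?B x * indicator F (vec_add q x z) :: ennreal)" by simp
    qed
    finally show "(\<integral>\<^sup>+x. indicator ?B x * indicator F (vec_add q x (mat_app q A y)) \<partial>?L)
        = (\<integral>\<^sup>+x. indicator ?B (vec_add q x (neg (mat_app q A y))) * indicator F x \<partial>?L)"
      by (simp add: z_def)
  qed
  also have "\<dots> = (\<integral>\<^sup>+x. (\<integral>\<^sup>+y. indicator ?B (vec_add q x (neg (mat_app q A y))) * indicator F x \<partial>?L) \<partial>?L)"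
    by (rule Fubini') measurable
  also have "\<dots> = (\<integral>\<^sup>+x. emeasure ?L ?B * indicator F x \<partial>?L)"
  proof (rule nn_integral_cong)
    fix x assume "x \<in> space ?L"
    then have x: "x \<in> vecs q" by simp
    have "(\<integral>\<^sup>+y. indicator ?B (vec_add q x (neg (mat_app q A y))) * indicator F x \<partial>?L)
        = (\<integral>\<^sup>+y. indicator ?B (vec_add q (neg (?T x)) y) * indicator F x \<partial>?L)"
    proof (intro nn_integral_cong)
      fix y assume "y \<in> space ?L"
      then have y: "y \<in> vecs q" by simp
      \<comment> \<open>With \<open>u = y - A^T x\<close> one has \<open>x - A y = - A u\<close>,
        and the ball is invariant under both \<open>A\<close> and the change of sign.\<close>
      define u where "u = vec_add q (neg (?T x)) y"
      have "vec_add q x (neg (mat_app q A y)) = vec_scale q (-1) (mat_app q A u)"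
      proof -
        have "mat_app q A u = vec_add q (neg x) (mat_app q A y)"
          by (simp add: u_def mat_app_vec_add neg_def mat_app_vec_scale AT[OF x])
        then show ?thesis
          by (intro vecs_eqI[OF vec_add_vecs vec_scale_vecs]) (auto simp: vec_add_def neg_def vec_scale_def)
      qed
      moreover have "inner_q q (mat_app q A u) (mat_app q A u) = inner_q q u u"
        by (rule inner_q_orthogonal[OF A]) (simp add: u_def)
      ultimately have "vec_add q x (neg (mat_app q A y)) \<in> ?B \<longleftrightarrow> u \<in> ?B"
        by (simp add: unit_ball_q_def inner_q_vec_scale) (simp add: u_def)
      then show "indicator ?B (vec_add q x (neg (mat_app q A y))) * indicator F x
        = (indicator ?B (vec_add q (neg (?T x)) y) * indicator F x :: ennreal)"
        by (simp add: u_def indicator_def)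
    qed
    also have "\<dots> = (\<integral>\<^sup>+y. indicator ?B y * indicator F x \<partial>?L)"
      by (rule nn_integral_lebesgue_q_translate) measurable
    also have "\<dots> = emeasure ?L ?B * indicator F x"
      by (subst nn_integral_multc) auto
    finally show "(\<integral>\<^sup>+y. indicator ?B (vec_add q x (neg (mat_app q A y))) * indicator F x \<partial>?L)
      = emeasure ?L ?B * indicator F x" .
  qed
  also have "\<dots> = emeasure ?L ?B * emeasure ?L F"
    by (subst nn_integral_cmult) auto
  \<comment> \<open>The common factor is the volume of the ball, which may be cancelled because it
    is neither 0 nor infinite.\<close>
  finally show ?thesis
    using emeasure_unit_ball_q_pos[OF q] emeasure_unit_ball_q_finite[of q]
    by (subst (asm) ennreal_mult_cancel_left) auto
qed

section \<open>Existence of the uniform distribution\<close>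

text \<open>Invariance of the hyperplane makes the column sums equal to one number \<open>s\<close>,
  and \<open>A A^T = 1\<close> then makes every row sum \<open>1 / s\<close>. Adding up all entries
  in both ways gives \<open>s = 1 / s\<close>. Hence the all-ones vector is an eigenvector of
  \<open>A\<close> and of its transpose.\<close>

lemma hyp_rotation_row_col_sums:
  assumes A: "hyp_rotation q A" and q: "q > 0"
  obtains s where "\<And>j. j \<in> {1..q} \<Longrightarrow> (\<Sum>i=1..q. A i j) = s"
    "\<And>i. i \<in> {1..q} \<Longrightarrow> (\<Sum>j=1..q. A i j) = s"
proof -
  define s where "s = (\<Sum>i=1..q. A i 1)"
  define r where "r i = (\<Sum>j=1..q. A i j)" for i
  have one: "1 \<in> {1..q}" using q by simp
  have col: "(\<Sum>i=1..q. A i j) = s" if j: "j \<in> {1..q}" for j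
  proof (cases "j = 1")
    case False
    \<comment> \<open>The vector \<open>e_j - e_1\<close> lies in the hyperplane, and so does its
      image, the difference of columns \<open>j\<close> and 1.\<close>
    define u :: "nat \<Rightarrow> real" where
      "u = (\<lambda>k\<in>{1..q}. (if k = j then 1 else 0) - (if k = 1 then 1 else 0))"
    have "u \<in> hyp q"
      unfolding hyp_iff using j one by (simp add: u_def vecs_def sum_subtractf)
    then have "mat_app q A u \<in> hyp q" using A unfolding hyp_rotation_def by blast
    then have "0 = (\<Sum>i=1..q. mat_app q A u i)" by (simp add: hyp_iff)
    also have "\<dots> = (\<Sum>i=1..q. A i j - A i 1)"
    proof (intro sum.cong refl)
      fix i assume i: "i \<in> {1..q}"
      have "mat_app q A u i = (\<Sum>k=1..q. (if k = j then A i k else 0) - (if k = 1 then A i k else 0))"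
        using i unfolding mat_app_def
        by (simp, intro sum.cong refl) (auto simp: u_def)
      then show "mat_app q A u i = A i j - A i 1"
        using j one by (simp add: sum_subtractf)
    qed
    finally show ?thesis by (simp add: sum_subtractf s_def)
  qed (simp add: s_def)
  have At: "orthogonal_q q (\<lambda>i j. A j i)"
    by (rule orthogonal_q_transpose[OF hyp_rotation_orthogonal[OF A]])
  have sr: "s * r i = 1" if i: "i \<in> {1..q}" for i
  proof -
    \<comment> \<open>The products of row \<open>i\<close> with all rows \<open>k\<close> are summed
      over \<open>k\<close>; by \<open>A A^T = 1\<close> only \<open>k = i\<close>
      contributes.\<close>
    have "s * r i = (\<Sum>j=1..q. (\<Sum>k=1..q. A k j) * A i j)"
      unfolding r_def sum_distrib_left by (intro sum.cong refl) (simp only: col)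
    also have "\<dots> = (\<Sum>k=1..q. \<Sum>j=1..q. A i j * A k j)"
      unfolding sum_distrib_right by (subst sum.swap) (simp only: mult.commute)
    also have "\<dots> = (\<Sum>k=1..q. if i = k then 1 else 0)"
      using At i unfolding orthogonal_q_def by (intro sum.cong refl) blast
    also have "\<dots> = 1" using i by simp
    finally show ?thesis .
  qed
  have s0: "s \<noteq> 0" using sr[OF one] by auto
  have r: "r i = 1 / s" if "i \<in> {1..q}" for i
    using sr[OF that] s0 by (simp add: field_simps)
  have "(\<Sum>i=1..q. r i) = (\<Sum>j=1..q. \<Sum>i=1..q. A i j)"
    unfolding r_def by (rule sum.swap)
  also have "\<dots> = (\<Sum>j=1..q. s)" by (intro sum.cong refl col)
  finally have "real q * (1 / s) = real q * s" using r by simp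
  then have "1 / s = s" using q by (simp only: mult_cancel_left) simp
  then show ?thesis using that[of s] col r by (simp add: r_def)
qed

section \<open>Orthogonal projection to the hyperplane\<close>

lemma proj_hyp_vecs [simp]: "proj_hyp q v \<in> vecs q"
  by (auto simp: proj_hyp_def vecs_def)

lemma proj_hyp_in_hyp:
  assumes "q > 0"
  shows "proj_hyp q v \<in> hyp q"
proof -
  have "(\<Sum>i=1..q. proj_hyp q v i) = (\<Sum>i=1..q. v i) - real q * (1 / real q * (\<Sum>i=1..q. v i))"
    by (simp add: proj_hyp_def ones_def sum_subtractf)
  also have "\<dots> = 0" using assms by simp
  finally show ?thesis by (simp add: hyp_iff)
qed

text \<open>Column sums \<open>s\<close> multiply the mean by \<open>s\<close>, and row sums
  \<open>s\<close> turn the constant vector \<open>m\<close> into the constant vector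
  \<open>s m\<close>, so subtracting the mean commutes with \<open>A\<close>.\<close>

lemma proj_hyp_mat_app:
  assumes A: "hyp_rotation q A" and q: "q > 0"
  shows "proj_hyp q (mat_app q A v) = mat_app q A (proj_hyp q v)"
proof -
  obtain s where col: "\<And>j. j \<in> {1..q} \<Longrightarrow> (\<Sum>i=1..q. A i j) = s"
    and row: "\<And>i. i \<in> {1..q} \<Longrightarrow> (\<Sum>j=1..q. A i j) = s"
    using hyp_rotation_row_col_sums[OF A q] by blast
  define m where "m = 1 / real q * (\<Sum>i=1..q. v i)"
  have "(\<Sum>i=1..q. mat_app q A v i) = (\<Sum>i=1..q. \<Sum>j=1..q. A i j * v j)"
    by (intro sum.cong refl) (simp add: mat_app_def)
  also have "\<dots> = (\<Sum>j=1..q. (\<Sum>i=1..q. A i j) * v j)"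
    unfolding sum_distrib_right by (rule sum.swap)
  also have "\<dots> = (\<Sum>j=1..q. s * v j)" by (intro sum.cong refl) (simp only: col)
  also have "\<dots> = s * (\<Sum>j=1..q. v j)" by (rule sum_distrib_left[symmetric])
  finally have m: "1 / real q * (\<Sum>i=1..q. mat_app q A v i) = s * m" by (simp add: m_def)
  show ?thesis
  proof (rule vecs_eqI[OF proj_hyp_vecs mat_app_vecs])
    fix i assume i: "i \<in> {1..q}"
    have "mat_app q A (proj_hyp q v) i = (\<Sum>j=1..q. A i j * v j - A i j * m)"
      using i unfolding mat_app_def
      by (simp, intro sum.cong refl) (simp add: proj_hyp_def ones_def m_def right_diff_distrib)
    also have "\<dots> = mat_app q A v i - s * m"
      using i row[OF i] by (simp add: sum_subtractf mat_app_def flip: sum_distrib_right)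
    also have "\<dots> = proj_hyp q (mat_app q A v) i"
      using i unfolding proj_hyp_def m by (simp add: ones_def)
    finally show "proj_hyp q (mat_app q A v) i = mat_app q A (proj_hyp q v) i" ..
  qed
qed

lemma measurable_proj_hyp [measurable]:
  "proj_hyp q \<in> measurable (lebesgue_q q) (lebesgue_q q)"
proof (rule measurable_into_lebesgue_q)
  fix i assume "i \<in> {1..q}"
  then show "(\<lambda>v. proj_hyp q v i) \<in> borel_measurable (lebesgue_q q)"
    by (auto simp: proj_hyp_def intro!: borel_measurable_diff borel_measurable_times borel_measurable_sum)
qed simp

text \<open>Vectors with zero projection cannot be normalized; they are removed beforehand, so that
  the radial projection is defined on the whole set.\<close>

definition proj_ball :: "nat \<Rightarrow> (nat \<Rightarrow> real) set" where
  "proj_ball q = {v \<in> unit_ball_q q. norm_q q (proj_hyp q v) > 0}"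

lemma measurable_norm_proj [measurable]:
  "(\<lambda>v. norm_q q (proj_hyp q v)) \<in> borel_measurable (lebesgue_q q)"
  unfolding norm_q_def
  using measurable_inner_q[OF measurable_proj_hyp measurable_proj_hyp] by measurable

lemma proj_ball_sets [measurable]: "proj_ball q \<in> sets (lebesgue_q q)"
proof -
  have "proj_ball q = unit_ball_q q \<inter> {v \<in> space (lebesgue_q q). norm_q q (proj_hyp q v) > 0}"
    by (auto simp: proj_ball_def unit_ball_q_def)
  also have "\<dots> \<in> sets (lebesgue_q q)" by measurable
  finally show ?thesis .
qed

lemma inner_q_pos:
  assumes "i \<in> {1..q}" "v i \<noteq> 0"
  shows "inner_q q v v > 0"
proof -
  have "0 < v i * v i" using assms(2) not_real_square_gt_zero by blast
  also have "\<dots> \<le> inner_q q v v" unfolding inner_q_def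
    by (rule member_le_sum) (use assms in auto)
  finally show ?thesis .
qed

text \<open>Subtracting the mean keeps the difference of two components, so the two projected
  components cannot both vanish.\<close>

lemma norm_proj_hyp_pos:
  assumes "i \<in> {1..q}" "j \<in> {1..q}" "v i \<noteq> v j"
  shows "norm_q q (proj_hyp q v) > 0"
proof -
  have "proj_hyp q v i \<noteq> 0 \<or> proj_hyp q v j \<noteq> 0"
    using assms by (auto simp: proj_hyp_def ones_def)
  then show ?thesis using assms inner_q_pos by (auto simp: norm_q_def)
qed

text \<open>The witness is a box inside the ball whose first coordinate is positive while all others
  are at most 0; there \<open>v 1\<close> and \<open>v 2\<close> differ, so the projection is
  nonzero.\<close>

lemma emeasure_proj_ball_pos:
  assumes "q \<ge> 2"
  shows "emeasure (lebesgue_q q) (proj_ball q) > 0"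
proof -
  define B :: "nat \<Rightarrow> real set" where
    "B i = (if i = 1 then {1 / (2 * real q)..1 / real q} else {-1 / real q..0})" for i
  have le: "1 / (2 * real q) \<le> 1 / real q" using assms by (simp add: field_simps)
  have sub: "Pi\<^sub>E {1..q} B \<subseteq> proj_ball q"
  proof
    fix v assume v: "v \<in> Pi\<^sub>E {1..q} B"
    have Bi: "B i \<subseteq> {-1 / real q..1 / real q}" for i
    proof -
      have "-1 / real q \<le> 0" "0 \<le> 1 / (2 * real q)" "0 \<le> 1 / real q" by simp_all
      then show ?thesis using le unfolding B_def by (auto simp del: divide_minus_left)
    qed
    have "v \<in> unit_ball_q q"
      using v PiE_mono[of "{1..q}" B "\<lambda>_. {-1 / real q..1 / real q}"] Bi
        small_box_subset_unit_ball[of q] by blast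
    moreover have "v 1 \<in> B 1" "v 2 \<in> B 2" using assms by (auto intro!: PiE_mem[OF v])
    then have "v 1 \<ge> 1 / (2 * real q)" "v 2 \<le> 0" by (auto simp: B_def)
    moreover have "1 / (2 * real q) > 0" using assms by simp
    ultimately have "v \<in> unit_ball_q q" "v 1 \<noteq> v 2" by (blast, linarith)
    then show "v \<in> proj_ball q"
      using assms norm_proj_hyp_pos[of 1 q 2 v] by (simp add: proj_ball_def)
  qed
  have "0 < ennreal (\<Prod>i=1..q. if i = 1 then 1 / real q - 1 / (2 * real q) else 1 / real q)"
    using assms by (subst ennreal_less_zero_iff) (intro prod_pos, simp add: field_simps)
  also have "\<dots> = (\<Prod>i=1..q. emeasure lborel (B i))"
    using le by (subst prod_ennreal[symmetric]) (auto simp: B_def intro!: prod.cong)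
  also have "\<dots> = emeasure (lebesgue_q q) (Pi\<^sub>E {1..q} B)"
    by (subst emeasure_lebesgue_q_box) (auto simp: B_def)
  also have "\<dots> \<le> emeasure (lebesgue_q q) (proj_ball q)"
    by (intro emeasure_mono sub proj_ball_sets)
  finally show ?thesis .
qed

lemma emeasure_proj_ball_finite: "emeasure (lebesgue_q q) (proj_ball q) < \<infinity>"
proof -
  have "emeasure (lebesgue_q q) (proj_ball q) \<le> emeasure (lebesgue_q q) (unit_ball_q q)"
    by (intro emeasure_mono unit_ball_q_sets) (auto simp: proj_ball_def)
  also note emeasure_unit_ball_q_finite
  finally show ?thesis .
qed

lemma norm_q_mat_app:
  assumes "hyp_rotation q A" "v \<in> vecs q"
  shows "norm_q q (mat_app q A v) = norm_q q v"
  using inner_q_orthogonal[OF hyp_rotation_orthogonal[OF assms(1)] assms(2)]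
  by (simp add: norm_q_def)

lemma mat_app_proj_ball_iff:
  assumes A: "hyp_rotation q A" and q: "q > 0" and v: "v \<in> vecs q"
  shows "mat_app q A v \<in> proj_ball q \<longleftrightarrow> v \<in> proj_ball q"
  using inner_q_orthogonal[OF hyp_rotation_orthogonal[OF A] v] v
  by (simp add: proj_ball_def unit_ball_q_def proj_hyp_mat_app[OF A q] norm_q_mat_app[OF A])

text \<open>Both the set \<open>proj_ball q\<close> and Lebesgue measure are preserved by
  \<open>A\<close>, so normalized restriction is preserved too.\<close>

lemma distr_uniform_proj_ball:
  assumes A: "hyp_rotation q A" and q: "q > 0"
  shows "distr (uniform_measure (lebesgue_q q) (proj_ball q)) (lebesgue_q q) (mat_app q A)
    = uniform_measure (lebesgue_q q) (proj_ball q)" (is "distr ?\<mu> _ _ = _")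
proof (rule measure_eqI)
  fix F assume "F \<in> sets (distr ?\<mu> (lebesgue_q q) (mat_app q A))"
  then have F [measurable]: "F \<in> sets (lebesgue_q q)" by simp
  have m: "mat_app q A -` F \<inter> space (lebesgue_q q) \<in> sets (lebesgue_q q)" by measurable
  have "emeasure (distr ?\<mu> (lebesgue_q q) (mat_app q A)) F
      = emeasure ?\<mu> (mat_app q A -` F \<inter> space (lebesgue_q q))"
    by (subst emeasure_distr) auto
  also have "\<dots> = emeasure (lebesgue_q q) (proj_ball q \<inter> (mat_app q A -` F \<inter> vecs q))
      / emeasure (lebesgue_q q) (proj_ball q)"
    using m by simp
  also have "proj_ball q \<inter> (mat_app q A -` F \<inter> vecs q)
      = mat_app q A -` (proj_ball q \<inter> F) \<inter> vecs q"
    using mat_app_proj_ball_iff[OF A q] by auto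
  also have "emeasure (lebesgue_q q) \<dots> = emeasure (lebesgue_q q) (proj_ball q \<inter> F)"
    by (rule emeasure_lebesgue_q_orthogonal[OF hyp_rotation_orthogonal[OF A] q]) measurable
  finally show "emeasure (distr ?\<mu> (lebesgue_q q) (mat_app q A)) F = emeasure ?\<mu> F" by simp
qed simp

lemma vec_scale_hyp: "v \<in> hyp q \<Longrightarrow> vec_scale q c v \<in> hyp q"
  by (simp add: hyp_iff) (simp add: vec_scale_def flip: sum_distrib_left)

lemma mat_app_hyp_sphere:
  assumes "hyp_rotation q A" "v \<in> hyp_sphere q \<rho>"
  shows "mat_app q A v \<in> hyp_sphere q \<rho>"
  using assms by (auto simp: hyp_sphere_def norm_q_mat_app hyp_iff)
    (simp_all add: hyp_rotation_def hyp_iff)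

text \<open>The measure is the image of the uniform measure on \<open>proj_ball q\<close> under
  projection to the hyperplane followed by rescaling to norm \<rho>. This map commutes with every
  rotation of the hyperplane, so the image inherits invariance.\<close>

lemma rotation_invariant_prob_exists:
  assumes q: "q \<ge> 2" and \<rho>: "\<rho> > 0"
  shows "\<exists>U. rotation_invariant_prob q \<rho> U"
proof -
  let ?L = "lebesgue_q q" and ?K = "proj_ball q"
  define \<mu> where "\<mu> = uniform_measure ?L ?K"
  define S where "S = restrict_space ?L (hyp_sphere q \<rho>)"
  define g where "g v = vec_scale q (\<rho> / norm_q q (proj_hyp q v)) (proj_hyp q v)" for v
  have q0: "q > 0" using q by simp
  have g: "g v \<in> hyp_sphere q \<rho>" if "norm_q q (proj_hyp q v) > 0" for v
  proof -
    have "inner_q q (g v) (g v) = \<rho>\<^sup>2"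
      using that by (simp add: g_def inner_q_vec_scale power_divide norm_q_square[symmetric, of q "proj_hyp q v"])
    moreover have "g v \<in> hyp q" unfolding g_def by (intro vec_scale_hyp proj_hyp_in_hyp q0)
    ultimately show ?thesis using \<rho> by (simp add: hyp_sphere_iff)
  qed
  have "?K \<noteq> {}" using emeasure_proj_ball_pos[OF q] by auto
  then obtain v0 where "v0 \<in> ?K" by blast
  then have v0: "g v0 \<in> hyp_sphere q \<rho>" by (auto simp: proj_ball_def intro: g)
  \<comment> \<open>The default value \<open>g v0\<close> makes \<open>h\<close> map every vector to
    the sphere, as measurability into \<open>S\<close> demands.\<close>
  define h where "h v = (if norm_q q (proj_hyp q v) > 0 then g v else g v0)" for v
  have gm [measurable]: "g \<in> measurable ?L ?L"
  proof (rule measurable_into_lebesgue_q)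
    fix i assume i: "i \<in> {1..q}"
    have "(\<lambda>v. proj_hyp q v i) \<in> borel_measurable ?L"
      by (rule measurable_compose[OF measurable_proj_hyp measurable_lebesgue_q_component[OF i]])
    then have "(\<lambda>v. \<rho> / norm_q q (proj_hyp q v) * proj_hyp q v i) \<in> borel_measurable ?L"
      by measurable
    moreover have "(\<lambda>v. g v i) = (\<lambda>v. \<rho> / norm_q q (proj_hyp q v) * proj_hyp q v i)"
      using i by (simp add: g_def vec_scale_def)
    ultimately show "(\<lambda>v. g v i) \<in> borel_measurable ?L" by (simp only:)
  qed (simp add: g_def)
  have "(\<lambda>v. g v0) \<in> measurable ?L ?L" by (rule measurable_const) (simp add: g_def)
  then have hm': "h \<in> measurable ?L ?L" unfolding h_def by measurable
  have hS: "h v \<in> hyp_sphere q \<rho>" for v using g v0 by (simp add: h_def)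
  have hm [measurable]: "h \<in> measurable ?L S"
    unfolding S_def by (rule measurable_restrict_space2[OF _ hm']) (use hS in auto)
  have sphere_vecs: "hyp_sphere q \<rho> \<subseteq> vecs q" by (auto simp: hyp_sphere_def hyp_def)
  have \<mu>: "prob_space \<mu>" unfolding \<mu>_def
    using emeasure_proj_ball_pos[OF q] emeasure_proj_ball_finite[of q]
    by (intro prob_space_uniform_measure) auto
  have sets_\<mu> [measurable_cong]: "sets \<mu> = sets ?L" by (simp add: \<mu>_def)
  have "distr (distr \<mu> S h) (distr \<mu> S h) (mat_app q A) = distr \<mu> S h" if A: "hyp_rotation q A" for A
  proof -
    have Am [measurable]: "mat_app q A \<in> measurable S S"
      unfolding S_def
      by (intro measurable_restrict_space2 measurable_restrict_space1 measurable_mat_app)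
        (use mat_app_hyp_sphere[OF A] in \<open>auto simp: space_restrict_space\<close>)
    have "distr (distr \<mu> S h) (distr \<mu> S h) (mat_app q A) = distr (distr \<mu> S h) S (mat_app q A)"
      by (rule distr_cong) simp_all
    also have "\<dots> = distr \<mu> S (mat_app q A \<circ> h)"
      by (rule distr_distr) measurable
    also have "\<dots> = distr \<mu> S (h \<circ> mat_app q A)"
    \<comment> \<open>Where the projection vanishes, \<open>h\<close> takes its default value, which
      rotations may move. The set \<open>?K\<close> has full measure and avoids these
      points.\<close>
    proof (rule distr_cong_AE[OF refl refl])
      have "mat_app q A (h v) = h (mat_app q A v)" if "v \<in> ?K" for v
        using that by (simp add: h_def g_def proj_ball_def proj_hyp_mat_app[OF A q0]
            norm_q_mat_app[OF A] mat_app_vec_scale)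
      then show "AE v in \<mu>. (mat_app q A \<circ> h) v = (h \<circ> mat_app q A) v"
        unfolding \<mu>_def by (intro AE_uniform_measureI) auto
    qed measurable
    also have "\<dots> = distr (distr \<mu> ?L (mat_app q A)) S h"
      by (rule distr_distr[symmetric]) measurable
    also have "\<dots> = distr \<mu> S h"
      unfolding \<mu>_def distr_uniform_proj_ball[OF A q0] ..
    finally show ?thesis .
  qed
  moreover have "prob_space (distr \<mu> S h)"
    by (rule prob_space.prob_space_distr[OF \<mu>]) measurable
  moreover have "space S = hyp_sphere q \<rho>"
    using sphere_vecs by (auto simp: S_def space_restrict_space)
  moreover have "sets S = sets (restrict_space (Pi\<^sub>M {1..q} (\<lambda>_. borel)) (hyp_sphere q \<rho>))"
    unfolding S_def by (rule sets_restrict_space_cong[OF sets_lebesgue_q])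
  ultimately show ?thesis
    unfolding rotation_invariant_prob_def by (intro exI[of _ "distr \<mu> S h"]) simp
qed

text \<open>Links the measure picked by \<open>SOME\<close> to the locale
  \<open>invariant_sphere\<close>, whose results hold for any rotation-invariant probability
  measure.\<close>

lemma rotation_invariant_unif_sphere:
  assumes "q \<ge> 2" "\<rho> > 0"
  shows "rotation_invariant_prob q \<rho> (unif_sphere q \<rho>)"
  unfolding unif_sphere_def by (rule someI_ex[OF rotation_invariant_prob_exists[OF assms]])

section \<open>Moments of the uniform distribution\<close>

text \<open>The Householder matrix \<open>1 - 2 u u^T / (u^T u)\<close>, which reflects in the
  hyperplane orthogonal to \<open>u\<close>.\<close>

definition reflection_q :: "nat \<Rightarrow> (nat \<Rightarrow> real) \<Rightarrow> nat \<Rightarrow> nat \<Rightarrow> real" where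
  "reflection_q q u i j = (if i = j then 1 else 0) - 2 / inner_q q u u * u i * u j"

lemma mat_app_reflection_q:
  assumes "i \<in> {1..q}"
  shows "mat_app q (reflection_q q u) v i = v i - 2 / inner_q q u u * inner_q q u v * u i"
proof -
  have "mat_app q (reflection_q q u) v i
      = (\<Sum>j=1..q. (if i = j then v j else 0) - 2 / inner_q q u u * u i * (u j * v j))"
    using assms unfolding mat_app_def reflection_q_def
    by (simp, intro sum.cong refl) (simp add: algebra_simps)
  also have "\<dots> = v i - 2 / inner_q q u u * u i * inner_q q u v"
    unfolding sum_subtractf sum_distrib_left[symmetric] inner_q_def[of q u v] using assms by simp
  finally show ?thesis by (simp add: mult_ac)
qed

text \<open>With \<open>c = 2 / inner_q q u u\<close> the correction terms
  \<open>-2 c u_i u_j\<close> and \<open>c^2 u_i u_j inner_q q u u\<close> cancel. The hyperplane is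
  preserved because \<open>v\<close> changes by a multiple of \<open>u\<close>.\<close>

lemma hyp_rotation_reflection_q:
  assumes u: "u \<in> hyp q" "inner_q q u u \<noteq> 0"
  shows "hyp_rotation q (reflection_q q u)"
  unfolding hyp_rotation_def
proof (intro conjI ballI)
  fix i j assume ij: "i \<in> {1..q}" "j \<in> {1..q}"
  define c where "c = 2 / inner_q q u u"
  define \<delta> :: "nat \<Rightarrow> nat \<Rightarrow> real" where "\<delta> i j = (if i = j then 1 else 0)" for i j
  have "(\<Sum>k=1..q. reflection_q q u k i * reflection_q q u k j)
      = (\<Sum>k=1..q. (if k = i then \<delta> k j else 0) - (if k = i then c * u i * u j else 0)
          - (if k = j then c * u i * u j else 0) + c\<^sup>2 * u i * u j * (u k * u k))"
    by (intro sum.cong refl)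
      (auto simp: reflection_q_def \<delta>_def power2_eq_square algebra_simps simp flip: c_def)
  also have "\<dots> = \<delta> i j - 2 * c * u i * u j + c\<^sup>2 * u i * u j * inner_q q u u"
    using ij by (simp add: sum.distrib sum_subtractf inner_q_def flip: sum_distrib_left)
  also have "\<dots> = \<delta> i j"
    using u(2) by (simp add: c_def power2_eq_square)
  finally show "(\<Sum>k=1..q. reflection_q q u k i * reflection_q q u k j) = (if i = j then 1 else 0)"
    by (simp add: \<delta>_def)
next
  fix v assume v: "v \<in> hyp q"
  have "(\<Sum>i=1..q. mat_app q (reflection_q q u) v i)
      = (\<Sum>i=1..q. v i - 2 / inner_q q u u * inner_q q u v * u i)"
    by (intro sum.cong refl mat_app_reflection_q)
  also have "\<dots> = 0"
    unfolding sum_subtractf sum_distrib_left[symmetric] using u(1) v by (simp add: hyp_iff)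
  finally show "mat_app q (reflection_q q u) v \<in> hyp q" by (simp add: hyp_iff)
qed

lemma inner_q_vec_add: "inner_q q v (vec_add q w z) = inner_q q v w + inner_q q v z"
  by (simp add: inner_q_def vec_add_def sum.distrib algebra_simps)

lemma inner_q_vec_scale_right: "inner_q q v (vec_scale q c w) = c * inner_q q v w"
  by (simp add: inner_q_def vec_scale_def sum_distrib_left mult_ac)

lemma inner_q_vec_add_left: "inner_q q (vec_add q w z) v = inner_q q w v + inner_q q z v"
  using inner_q_vec_add[of q v w z] by (simp only: inner_q_commute)

lemma inner_q_vec_scale_left: "inner_q q (vec_scale q c w) v = c * inner_q q w v"
  using inner_q_vec_scale_right[of q v c w] by (simp only: inner_q_commute)

lemma vec_add_hyp: "v \<in> hyp q \<Longrightarrow> w \<in> hyp q \<Longrightarrow> vec_add q v w \<in> hyp q"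
  by (simp add: hyp_iff) (simp add: vec_add_def sum.distrib)

text \<open>The vector \<open>e_i - e_j\<close>. In contrast to the unit vectors it lies in the
  hyperplane, which is why coordinate differences are studied instead of coordinates.\<close>

definition diff_vec :: "nat \<Rightarrow> nat \<Rightarrow> nat \<Rightarrow> nat \<Rightarrow> real" where
  "diff_vec q i j = (\<lambda>k\<in>{1..q}. (if k = i then 1 else 0) - (if k = j then 1 else 0))"

lemma inner_q_diff_vec:
  assumes "i \<in> {1..q}" "j \<in> {1..q}"
  shows "inner_q q v (diff_vec q i j) = v i - v j"
proof -
  have "inner_q q v (diff_vec q i j)
      = (\<Sum>k=1..q. (if k = i then v k else 0) - (if k = j then v k else 0))"
    unfolding inner_q_def by (intro sum.cong refl) (auto simp: diff_vec_def)
  then show ?thesis using assms by (simp add: sum_subtractf)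
qed

lemma diff_vec_hyp:
  assumes "i \<in> {1..q}" "j \<in> {1..q}"
  shows "diff_vec q i j \<in> hyp q"
  using assms unfolding hyp_iff by (auto simp: diff_vec_def vecs_def sum_subtractf)

lemma inner_q_diff_vec_self:
  assumes "i \<in> {1..q}" "j \<in> {1..q}" "i \<noteq> j"
  shows "inner_q q (diff_vec q i j) (diff_vec q i j) = 2"
  using assms by (simp only: inner_q_diff_vec) (simp add: diff_vec_def)

text \<open>After expanding the squares, the mixed terms vanish because the coordinates add up to
  0.\<close>

lemma sum_diff_squares_hyp_sphere:
  assumes "v \<in> hyp_sphere q \<rho>" "\<rho> \<ge> 0"
  shows "(\<Sum>i=1..q. \<Sum>j=1..q. (v i - v j)\<^sup>2) = 2 * real q * \<rho>\<^sup>2"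
proof -
  have v: "(\<Sum>i=1..q. v i) = 0" "(\<Sum>i=1..q. v i * v i) = \<rho>\<^sup>2"
    using assms by (simp_all add: hyp_sphere_iff hyp_iff inner_q_def)
  have "(\<Sum>i=1..q. \<Sum>j=1..q. v i * v i) = real q * \<rho>\<^sup>2"
    by (simp only: sum_constant sum_distrib_left[symmetric] v) simp
  moreover have "(\<Sum>i=1..q. \<Sum>j=1..q. 2 * v i * v j) = 0"
    by (simp only: sum_distrib_left[symmetric] v mult_zero_right sum.neutral_const)
  moreover have "(\<Sum>i=1..q. \<Sum>j=1..q. v j * v j) = real q * \<rho>\<^sup>2"
    by (simp add: v[simplified])
  moreover have "(\<Sum>i=1..q. \<Sum>j=1..q. (v i - v j)\<^sup>2)
      = (\<Sum>i=1..q. \<Sum>j=1..q. v i * v i - 2 * v i * v j + v j * v j)"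
    by (simp add: power2_eq_square algebra_simps)
  ultimately show ?thesis by (simp only: sum.distrib sum_subtractf)
qed

lemma sum_pairs:
  fixes f :: "nat \<Rightarrow> real"
  shows "(\<Sum>i=1..2 * m. f i) = (\<Sum>k<m. f (2 * k + 1) + f (2 * k + 2))"
  by (induction m) (simp_all add: add_ac)

text \<open>The pairs are disjoint and \<open>(a - b)^2\<close> is at most
  \<open>2 (a^2 + b^2)\<close>. An almost sure bound on this sum is what controls the fourth
  moment.\<close>

lemma sum_pair_diff_squares_le:
  assumes "v \<in> hyp_sphere (2 * m) \<rho>" "\<rho> \<ge> 0"
  shows "(\<Sum>k<m. (v (2 * k + 1) - v (2 * k + 2))\<^sup>2) \<le> 2 * \<rho>\<^sup>2"
proof -
  have "(\<Sum>k<m. (v (2 * k + 1) - v (2 * k + 2))\<^sup>2)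
      \<le> (\<Sum>k<m. 2 * (v (2 * k + 1) * v (2 * k + 1) + v (2 * k + 2) * v (2 * k + 2)))"
  proof (rule sum_mono)
    fix k
    show "(v (2 * k + 1) - v (2 * k + 2))\<^sup>2
        \<le> 2 * (v (2 * k + 1) * v (2 * k + 1) + v (2 * k + 2) * v (2 * k + 2))"
      using zero_le_power2[of "v (2 * k + 1) + v (2 * k + 2)"]
      by (simp add: power2_eq_square algebra_simps)
  qed
  also have "\<dots> = 2 * (\<Sum>i=1..2*m. v i * v i)"
    by (simp only: sum_pairs sum_distrib_left)
  also have "\<dots> = 2 * \<rho>\<^sup>2"
    using assms by (simp add: hyp_sphere_iff inner_q_def)
  finally show ?thesis .
qed

section \<open>Moments and tails of coordinate differences under an invariant measure\<close>

locale invariant_sphere =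
  fixes q :: nat and \<rho> :: real and U :: "(nat \<Rightarrow> real) measure"
  assumes invariant: "rotation_invariant_prob q \<rho> U" and rho_pos: "\<rho> > 0"
begin

sublocale prob_space U
  using invariant by (simp add: rotation_invariant_prob_def)

lemma space_U [simp]: "space U = hyp_sphere q \<rho>"
  using invariant by (simp add: rotation_invariant_prob_def)

lemma prob_hyp_sphere [simp]: "prob (hyp_sphere q \<rho>) = 1"
  using prob_space by simp

lemma sets_U: "sets U = sets (restrict_space (lebesgue_q q) (hyp_sphere q \<rho>))"
  using invariant unfolding rotation_invariant_prob_def
  by (simp add: sets_restrict_space_cong[OF sets_lebesgue_q])

lemma measurable_U:
  assumes "f \<in> borel_measurable (lebesgue_q q)"
  shows "f \<in> borel_measurable U"
  using measurable_restrict_space1[OF assms, of "hyp_sphere q \<rho>"]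
  by (simp add: measurable_cong_sets[OF sets_U refl])

lemma measurable_component_U [measurable]: "i \<in> {1..q} \<Longrightarrow> (\<lambda>v. v i) \<in> borel_measurable U"
  by (intro measurable_U measurable_lebesgue_q_component)

lemma measurable_inner_q_U [measurable]: "(\<lambda>v. inner_q q v w) \<in> borel_measurable U"
  unfolding inner_q_def by (intro borel_measurable_sum borel_measurable_times) auto

lemma measurable_hyp_rotation_U:
  assumes "hyp_rotation q A"
  shows "mat_app q A \<in> measurable U U"
proof -
  have "mat_app q A \<in> measurable (restrict_space (lebesgue_q q) (hyp_sphere q \<rho>))
      (restrict_space (lebesgue_q q) (hyp_sphere q \<rho>))"
    by (intro measurable_restrict_space2 measurable_restrict_space1 measurable_mat_app)
      (use mat_app_hyp_sphere[OF assms] in \<open>auto simp: space_restrict_space\<close>)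
  then show ?thesis by (simp add: measurable_cong_sets[OF sets_U sets_U])
qed

text \<open>The reflection along \<open>w - w'\<close> exchanges two vectors of equal norm, and the
  measure is invariant under it.\<close>

lemma integral_inner_q_eq:
  fixes \<phi> :: "real \<Rightarrow> real"
  assumes w: "w \<in> hyp q" "w' \<in> hyp q" and eq: "inner_q q w w = inner_q q w' w'"
    and \<phi> [measurable]: "\<phi> \<in> borel_measurable borel"
  shows "(\<integral>v. \<phi> (inner_q q v w) \<partial>U) = (\<integral>v. \<phi> (inner_q q v w') \<partial>U)"
proof (cases "w = w'")
  case False
  define u where "u = vec_add q w (vec_scale q (-1) w')"
  define R where "R = reflection_q q u"
  have u: "u \<in> hyp q" unfolding u_def by (intro vec_add_hyp vec_scale_hyp w)
  obtain i where i: "i \<in> {1..q}" "w i \<noteq> w' i"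
    using False w vecs_eqI[of w q w'] by (auto simp: hyp_iff)
  then have uu: "inner_q q u u > 0"
    by (intro inner_q_pos[of i]) (auto simp: u_def vec_add_def vec_scale_def)
  have A: "hyp_rotation q R"
    unfolding R_def using u uu by (intro hyp_rotation_reflection_q) auto
  note [measurable] = measurable_hyp_rotation_U[OF A]
  have sym: "(\<lambda>i j. R j i) = R"
    by (intro ext) (simp add: R_def reflection_q_def)
  \<comment> \<open>Here the equality of the norms enters; it makes the reflection add exactly
    \<open>u\<close> to \<open>w'\<close>.\<close>
  have uw: "inner_q q u u = - 2 * inner_q q u w'"
    using eq inner_q_commute[of q w w']
    by (simp add: u_def inner_q_vec_add inner_q_vec_add_left inner_q_vec_scale_right inner_q_vec_scale_left)
  have "mat_app q R w' = w"
  proof (rule vecs_eqI[OF mat_app_vecs])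
    show "w \<in> vecs q" using w by (simp add: hyp_iff)
    fix i assume i: "i \<in> {1..q}"
    have "mat_app q R w' i = w' i - 2 / inner_q q u u * inner_q q u w' * u i"
      unfolding R_def by (rule mat_app_reflection_q[OF i])
    also have "2 / inner_q q u u * inner_q q u w' = -1"
      using uw uu by (simp add: field_simps)
    finally show "mat_app q R w' i = w i" using i by (simp add: u_def vec_add_def vec_scale_def)
  qed
  then have inner: "inner_q q (mat_app q R v) w' = inner_q q v w" for v
    by (simp add: inner_q_mat_app sym)
  have "(\<integral>v. \<phi> (inner_q q v w') \<partial>U) = (\<integral>v. \<phi> (inner_q q v w') \<partial>distr U U (mat_app q R))"
    using invariant A by (simp add: rotation_invariant_prob_def)
  also have "\<dots> = (\<integral>v. \<phi> (inner_q q (mat_app q R v) w') \<partial>U)"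
    by (rule integral_distr) measurable
  finally show ?thesis by (simp add: inner)
qed simp

lemma integral_diff_eq:
  fixes \<phi> :: "real \<Rightarrow> real"
  assumes "i \<in> {1..q}" "j \<in> {1..q}" "i \<noteq> j" "a \<in> {1..q}" "b \<in> {1..q}" "a \<noteq> b"
    and "\<phi> \<in> borel_measurable borel"
  shows "(\<integral>v. \<phi> (v i - v j) \<partial>U) = (\<integral>v. \<phi> (v a - v b) \<partial>U)"
proof -
  have "inner_q q (diff_vec q i j) (diff_vec q i j) = inner_q q (diff_vec q a b) (diff_vec q a b)"
    using assms by (metis inner_q_diff_vec_self)
  then show ?thesis
    using integral_inner_q_eq[of "diff_vec q i j" "diff_vec q a b" \<phi>] assms
    by (simp only: inner_q_diff_vec diff_vec_hyp)
qed

lemma abs_diff_le: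
  assumes "v \<in> hyp_sphere q \<rho>" "i \<in> {1..q}" "j \<in> {1..q}"
  shows "\<bar>v i - v j\<bar> \<le> 2 * \<rho>"
proof -
  have "\<bar>v k\<bar> \<le> \<rho>" if "k \<in> {1..q}" for k
  proof -
    have "v k * v k \<le> inner_q q v v"
      unfolding inner_q_def by (rule member_le_sum) (use that in auto)
    also have "\<dots> = \<rho>\<^sup>2" using assms(1) rho_pos by (simp add: hyp_sphere_iff)
    finally show ?thesis using rho_pos abs_le_square_iff[of "v k" \<rho>]
      by (simp add: power2_eq_square)
  qed
  from this[OF assms(2)] this[OF assms(3)] show ?thesis by linarith
qed

lemma integrable_diff_powers:
  assumes "i \<in> {1..q}" "j \<in> {1..q}" "a \<in> {1..q}" "b \<in> {1..q}"
  shows "integrable U (\<lambda>v. (v i - v j) ^ k * (v a - v b) ^ l)"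
proof (rule integrable_const_bound[where B = "(2 * \<rho>) ^ k * (2 * \<rho>) ^ l"])
  show "AE v in U. norm ((v i - v j) ^ k * (v a - v b) ^ l) \<le> (2 * \<rho>) ^ k * (2 * \<rho>) ^ l"
  proof (rule AE_I2)
    fix v assume "v \<in> space U"
    then have "\<bar>v i - v j\<bar> ^ k * \<bar>v a - v b\<bar> ^ l \<le> (2 * \<rho>) ^ k * (2 * \<rho>) ^ l"
      using rho_pos assms by (intro mult_mono power_mono abs_diff_le) auto
    then show "norm ((v i - v j) ^ k * (v a - v b) ^ l) \<le> (2 * \<rho>) ^ k * (2 * \<rho>) ^ l"
      by (simp add: abs_mult power_abs)
  qed
  show "(\<lambda>v. (v i - v j) ^ k * (v a - v b) ^ l) \<in> borel_measurable U"
    using assms by measurable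
qed

lemma integrable_diff_power:
  assumes "i \<in> {1..q}" "j \<in> {1..q}"
  shows "integrable U (\<lambda>v. (v i - v j) ^ k)"
  using integrable_diff_powers[of i j i j k 0] assms by simp

text \<open>The squared differences over all ordered pairs have a constant sum on the sphere, and
  the \<open>q (q - 1)\<close> off-diagonal pairs have equal expectations.\<close>

lemma second_moment:
  assumes q: "q \<ge> 2"
  shows "(\<integral>v. (v 1 - v 2)\<^sup>2 \<partial>U) = 2 * \<rho>\<^sup>2 / (real q - 1)"
proof -
  define M where "M = (\<integral>v. (v 1 - v 2)\<^sup>2 \<partial>U)"
  have 12: "1 \<in> {1..q}" "2 \<in> {1..q}" "1 \<noteq> (2::nat)" using q by auto
  have M: "(\<integral>v. (v i - v j)\<^sup>2 \<partial>U) = (if i = j then 0 else M)"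
    if "i \<in> {1..q}" "j \<in> {1..q}" for i j
    using integral_diff_eq[of i j 1 2 "\<lambda>x. x\<^sup>2"] that 12 by (simp add: M_def)
  have "2 * real q * \<rho>\<^sup>2 = (\<integral>v. 2 * real q * \<rho>\<^sup>2 \<partial>U)" by simp
  also have "\<dots> = (\<integral>v. (\<Sum>i=1..q. \<Sum>j=1..q. (v i - v j)\<^sup>2) \<partial>U)"
    by (rule Bochner_Integration.integral_cong)
      (use sum_diff_squares_hyp_sphere[of _ q \<rho>] rho_pos in auto)
  also have "\<dots> = (\<Sum>i=1..q. \<integral>v. (\<Sum>j=1..q. (v i - v j)\<^sup>2) \<partial>U)"
    by (intro Bochner_Integration.integral_sum Bochner_Integration.integrable_sum integrable_diff_power)
  also have "\<dots> = (\<Sum>i=1..q. \<Sum>j=1..q. \<integral>v. (v i - v j)\<^sup>2 \<partial>U)"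
    by (intro sum.cong refl Bochner_Integration.integral_sum integrable_diff_power)
  also have "\<dots> = (\<Sum>i=1..q. \<Sum>j=1..q. M - (if i = j then M else 0))"
    by (intro sum.cong refl) (simp add: M)
  also have "\<dots> = real q * ((real q - 1) * M)" by (simp add: sum_subtractf algebra_simps)
  finally have "(real q - 1) * M = 2 * \<rho>\<^sup>2" using q by simp
  then show ?thesis using q by (simp add: M_def field_simps)
qed

text \<open>
  For orthogonal \<open>X\<close>, \<open>Y\<close> of equal norm, \<open>X + Y\<close> and \<open>X - Y\<close> are distributed like \<open>sqrt 2 X\<close>,
  and \<open>(X + Y)\<^sup>4 + (X - Y)\<^sup>4 = 2 X\<^sup>4 + 12 X\<^sup>2 Y\<^sup>2 + 2 Y\<^sup>4\<close>.
\<close>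

lemma mixed_fourth_moment:
  assumes i: "i \<in> {1..q}" "j \<in> {1..q}" "a \<in> {1..q}" "b \<in> {1..q}" and d: "distinct [i, j, a, b]"
  shows "(\<integral>v. (v i - v j)\<^sup>2 * (v a - v b)\<^sup>2 \<partial>U) = (\<integral>v. (v i - v j) ^ 4 \<partial>U) / 3"
proof -
  define M where "M = (\<integral>v. (v i - v j) ^ 4 \<partial>U)"
  let ?x = "diff_vec q i j" and ?y = "diff_vec q a b"
  note hyps = diff_vec_hyp[OF i(1,2)] diff_vec_hyp[OF i(3,4)]
  have "?x a = 0" "?x b = 0" using i d by (auto simp: diff_vec_def)
  then have xy: "inner_q q ?x ?y = 0" "inner_q q ?y ?x = 0"
    using inner_q_diff_vec[OF i(3,4), of ?x] inner_q_commute[of q ?x ?y] by auto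
  have xx: "inner_q q ?x ?x = 2" "inner_q q ?y ?y = 2"
    using i d by (auto intro!: inner_q_diff_vec_self)
  note in_simps = inner_q_vec_add inner_q_vec_add_left inner_q_vec_scale_right
    inner_q_vec_scale_left xx xy
  have scaled: "(\<integral>v. (inner_q q v (vec_add q ?x (vec_scale q c ?y))) ^ 4 \<partial>U) = 4 * M" if "c\<^sup>2 = 1" for c
  proof -
    have "(\<integral>v. (inner_q q v (vec_add q ?x (vec_scale q c ?y))) ^ 4 \<partial>U)
        = (\<integral>v. (inner_q q v (vec_scale q (sqrt 2) ?x)) ^ 4 \<partial>U)"
      using that by (intro integral_inner_q_eq[where \<phi> = "\<lambda>x. x ^ 4"] vec_add_hyp vec_scale_hyp hyps)
        (auto simp: in_simps power2_eq_square[of c, symmetric] mult.assoc[symmetric])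
    also have "\<dots> = (\<integral>v. 4 * (v i - v j) ^ 4 \<partial>U)"
    proof (intro Bochner_Integration.integral_cong refl)
      fix v
      have "(sqrt 2) ^ 4 = (4::real)"
        by (metis abs_numeral num_double numeral_times_numeral power2_eq_square power4_eq_xxxx
            mult.assoc real_sqrt_mult_self)
      then show "(inner_q q v (vec_scale q (sqrt 2) ?x)) ^ 4 = 4 * (v i - v j) ^ 4"
        by (simp only: inner_q_vec_scale_right inner_q_diff_vec[OF i(1,2)] power_mult_distrib)
    qed
    finally show ?thesis by (simp add: M_def)
  qed
  have in_xy: "inner_q q v (vec_add q ?x (vec_scale q c ?y)) = (v i - v j) + c * (v a - v b)" for v c
    by (simp only: inner_q_vec_add inner_q_vec_scale_right inner_q_diff_vec[OF i(1,2)]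
        inner_q_diff_vec[OF i(3,4)])
  note int = integrable_diff_powers[OF i] integrable_diff_power[OF i(1,2)]
    integrable_diff_power[OF i(3,4)]
  have plus: "(\<integral>v. ((v i - v j) + (v a - v b)) ^ 4 \<partial>U) = 4 * M"
    and minus: "(\<integral>v. ((v i - v j) - (v a - v b)) ^ 4 \<partial>U) = 4 * M"
    using scaled[of 1] scaled[of "-1"] unfolding in_xy mult_minus1 add_uminus_conv_diff mult_1
    by (simp_all only: power2_minus power_one simp_thms)
  \<comment> \<open>The exponents 1 are written out so that the summands match
    \<open>integrable_diff_powers\<close>.\<close>
  have expand: "(x + y) ^ 4 = x ^ 4 + 4 * (x ^ 3 * y ^ 1) + 6 * (x\<^sup>2 * y\<^sup>2) + 4 * (x ^ 1 * y ^ 3) + y ^ 4"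
    "(x - y) ^ 4 = x ^ 4 - 4 * (x ^ 3 * y ^ 1) + 6 * (x\<^sup>2 * y\<^sup>2) - 4 * (x ^ 1 * y ^ 3) + y ^ 4"
    for x y :: real
    by (simp_all add: power4_eq_xxxx power3_eq_cube power2_eq_square algebra_simps)
  have int_plus: "integrable U (\<lambda>v. ((v i - v j) + (v a - v b)) ^ 4)"
    and int_minus: "integrable U (\<lambda>v. ((v i - v j) - (v a - v b)) ^ 4)"
    by (subst expand, intro Bochner_Integration.integrable_add Bochner_Integration.integrable_diff
        integrable_mult_right int)+
  have My: "(\<integral>v. (v a - v b) ^ 4 \<partial>U) = M"
    unfolding M_def using i d by (intro integral_diff_eq[where \<phi> = "\<lambda>x. x ^ 4"]) auto
  have "8 * M = (\<integral>v. ((v i - v j) + (v a - v b)) ^ 4 \<partial>U) + (\<integral>v. ((v i - v j) - (v a - v b)) ^ 4 \<partial>U)"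
    by (simp only: plus minus)
  also have "\<dots> = (\<integral>v. ((v i - v j) + (v a - v b)) ^ 4 + ((v i - v j) - (v a - v b)) ^ 4 \<partial>U)"
    by (rule Bochner_Integration.integral_add[OF int_plus int_minus, symmetric])
  also have "\<dots> = (\<integral>v. 2 * (v i - v j) ^ 4 + 12 * ((v i - v j)\<^sup>2 * (v a - v b)\<^sup>2) + 2 * (v a - v b) ^ 4 \<partial>U)"
  proof (intro Bochner_Integration.integral_cong refl)
    fix v :: "nat \<Rightarrow> real"
    show "((v i - v j) + (v a - v b)) ^ 4 + ((v i - v j) - (v a - v b)) ^ 4
        = 2 * (v i - v j) ^ 4 + 12 * ((v i - v j)\<^sup>2 * (v a - v b)\<^sup>2) + 2 * (v a - v b) ^ 4"
      unfolding expand[of "v i - v j" "v a - v b"] by simp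
  qed
  also have "\<dots> = 2 * M + 12 * (\<integral>v. (v i - v j)\<^sup>2 * (v a - v b)\<^sup>2 \<partial>U) + 2 * (\<integral>v. (v a - v b) ^ 4 \<partial>U)"
    unfolding M_def by (simp add: int)
  finally show ?thesis by (simp add: My flip: M_def)
qed

text \<open>The sum of \<open>m\<close> squared differences over disjoint pairs is at most
  \<open>2 \<rho>^2\<close>. Squaring it yields \<open>m^2\<close> products whose expectations are
  \<open>M\<close> on the diagonal and \<open>M / 3\<close> elsewhere, so \<open>m^2 M / 3\<close>
  is at most \<open>4 \<rho>^4\<close>.\<close>

lemma fourth_moment_le:
  assumes q: "q = 2 * m" and m: "m \<ge> 1"
  shows "(\<integral>v. (v 1 - v 2) ^ 4 \<partial>U) \<le> 12 * \<rho> ^ 4 / (real m)\<^sup>2"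
proof -
  define M where "M = (\<integral>v. (v 1 - v 2) ^ 4 \<partial>U)"
  define X :: "nat \<Rightarrow> (nat \<Rightarrow> real) \<Rightarrow> real" where "X k v = v (2 * k + 1) - v (2 * k + 2)" for k v
  have idx: "2 * k + 1 \<in> {1..q}" "2 * k + 2 \<in> {1..q}" if "k \<in> {..<m}" for k
    using that q by auto
  have 12: "1 \<in> {1..q}" "2 \<in> {1..q}" using idx[of 0] m by auto
  have M0: "M \<ge> 0" unfolding M_def by (rule Bochner_Integration.integral_nonneg) simp
  have int: "integrable U (\<lambda>v. (X k v)\<^sup>2 * (X l v)\<^sup>2)" if "k \<in> {..<m}" "l \<in> {..<m}" for k l
    unfolding X_def using idx that by (intro integrable_diff_powers) auto
  have "M / 3 \<le> (\<integral>v. (X k v)\<^sup>2 * (X l v)\<^sup>2 \<partial>U)" if kl: "k \<in> {..<m}" "l \<in> {..<m}" for k l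
  proof -
    have Mk: "(\<integral>v. (X k v) ^ 4 \<partial>U) = M"
      unfolding X_def M_def using idx kl 12 by (intro integral_diff_eq[where \<phi> = "\<lambda>x. x ^ 4"]) auto
    show ?thesis
    proof (cases "k = l")
      case True
      have "(\<integral>v. (X k v)\<^sup>2 * (X l v)\<^sup>2 \<partial>U) = M"
        unfolding True Mk[unfolded True, symmetric]
        by (simp add: power2_eq_square power4_eq_xxxx mult.assoc)
      then show ?thesis using M0 by simp
    next
      case False
      have "distinct [2 * k + 1, 2 * k + 2, 2 * l + 1, 2 * l + 2]" using False by auto
      then have "(\<integral>v. (X k v)\<^sup>2 * (X l v)\<^sup>2 \<partial>U) = M / 3"
        unfolding Mk[symmetric] X_def using idx kl by (intro mixed_fourth_moment) auto
      then show ?thesis by simp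
    qed
  qed
  then have "(\<Sum>k<m. \<Sum>l<m. M / 3) \<le> (\<Sum>k<m. \<Sum>l<m. \<integral>v. (X k v)\<^sup>2 * (X l v)\<^sup>2 \<partial>U)"
    by (intro sum_mono)
  also have "\<dots> = (\<Sum>k<m. \<integral>v. (\<Sum>l<m. (X k v)\<^sup>2 * (X l v)\<^sup>2) \<partial>U)"
    by (intro sum.cong refl Bochner_Integration.integral_sum[symmetric] int)
  also have "\<dots> = (\<integral>v. (\<Sum>k<m. \<Sum>l<m. (X k v)\<^sup>2 * (X l v)\<^sup>2) \<partial>U)"
    by (intro Bochner_Integration.integral_sum[symmetric] Bochner_Integration.integrable_sum int)
  also have "\<dots> \<le> (\<integral>v. (2 * \<rho>\<^sup>2)\<^sup>2 \<partial>U)"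
  proof (rule integral_mono)
    show "integrable U (\<lambda>v. \<Sum>k<m. \<Sum>l<m. (X k v)\<^sup>2 * (X l v)\<^sup>2)"
      by (intro Bochner_Integration.integrable_sum int)
    fix v assume "v \<in> space U"
    then have "(\<Sum>k<m. (X k v)\<^sup>2) \<le> 2 * \<rho>\<^sup>2"
      unfolding X_def using sum_pair_diff_squares_le[of v m \<rho>] rho_pos q by simp
    then have "(\<Sum>k<m. (X k v)\<^sup>2)\<^sup>2 \<le> (2 * \<rho>\<^sup>2)\<^sup>2"
      by (intro power_mono sum_nonneg) auto
    then show "(\<Sum>k<m. \<Sum>l<m. (X k v)\<^sup>2 * (X l v)\<^sup>2) \<le> (2 * \<rho>\<^sup>2)\<^sup>2"
      by (simp add: sum_product power2_eq_square[of "\<Sum>k<m. (X k v)\<^sup>2"])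
  qed simp
  also have "\<dots> = 4 * \<rho> ^ 4" by (simp add: power_mult_distrib)
  finally have "(real m)\<^sup>2 * M \<le> 12 * \<rho> ^ 4" by (simp add: power2_eq_square)
  then show ?thesis using m by (simp add: M_def field_simps)
qed

text \<open>If \<open>v 1 - v 2\<close> rarely exceeded \<open>s\<close> in absolute value, its
  second moment would be too small, as the fourth moment prevents rare large values from supplying
  the rest.\<close>

lemma diff_tail:
  assumes q: "q = 2 * m" and m: "m \<ge> 1"
  shows "measure U {v \<in> hyp_sphere q \<rho>. \<rho> / sqrt (2 * real q) < v 1 - v 2} \<ge> 1 / 48"
proof -
  define s where "s = \<rho> / sqrt (2 * real q)"
  \<comment> \<open>Chosen so that the fourth-moment term below is at most
    \<open>\<rho>^2 / (2 q)\<close>, the same as \<open>s^2\<close>. Together they take half of the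
    lower bound \<open>2 \<rho>^2 / q\<close> for the second moment, and the tail probability must
    account for the other half.\<close>
  define K where "K = 48 * \<rho>\<^sup>2 / real q"
  define p where "p = measure U {v \<in> hyp_sphere q \<rho>. s < v 1 - v 2}"
  have q2: "q \<ge> 2" "real q = 2 * real m" using q m by auto
  have 12: "1 \<in> {1..q}" "2 \<in> {1..q}" using q2 by auto
  note [measurable] = measurable_component_U[OF 12(1)] measurable_component_U[OF 12(2)]
  have K: "K > 0" using rho_pos q2 by (simp add: K_def)
  have s2: "s\<^sup>2 = \<rho>\<^sup>2 / (2 * real q)" by (simp add: s_def power_divide)
  have "p = (\<integral>v. indicator {v \<in> hyp_sphere q \<rho>. s < v 1 - v 2} v \<partial>U)"
    by (simp add: p_def Int_def conj_commute)
  also have "\<dots> = (\<integral>v. indicator {s<..} (v 1 - v 2) \<partial>U)"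
    by (rule Bochner_Integration.integral_cong) (auto simp: indicator_def)
  finally have p1: "(\<integral>v. indicator {s<..} (v 1 - v 2) \<partial>U) = p" ..
  \<comment> \<open>Exchanging the two coordinates shows that both tails have probability
    \<open>p\<close>.\<close>
  have p2: "(\<integral>v. indicator {s<..} (v 2 - v 1) \<partial>U) = p"
    unfolding p1[symmetric] using 12 by (intro integral_diff_eq) auto
  have int: "integrable U (\<lambda>v. indicator {s<..} (v 1 - v 2) :: real)"
    "integrable U (\<lambda>v. indicator {s<..} (v 2 - v 1) :: real)"
    by (intro integrable_const_bound[where B = 1]; measurable; simp)+
  have "2 * \<rho>\<^sup>2 / real q \<le> 2 * \<rho>\<^sup>2 / (real q - 1)"
    using q2 by (intro divide_left_mono) auto
  also have "\<dots> = (\<integral>v. (v 1 - v 2)\<^sup>2 \<partial>U)" using second_moment[OF q2(1)] by simp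
  also have "\<dots> \<le> (\<integral>v. s\<^sup>2 + K / 2 * (indicator {s<..} (v 1 - v 2) + indicator {s<..} (v 2 - v 1))
      + 1 / (2 * K) * (v 1 - v 2) ^ 4 \<partial>U)"
  proof (rule integral_mono)
    show "integrable U (\<lambda>v. (v 1 - v 2)\<^sup>2)" by (intro integrable_diff_power 12)
    show "integrable U (\<lambda>v. s\<^sup>2 + K / 2 * (indicator {s<..} (v 1 - v 2) + indicator {s<..} (v 2 - v 1))
      + 1 / (2 * K) * (v 1 - v 2) ^ 4)"
      using int integrable_diff_power[OF 12, of 4] by simp
    fix v :: "nat \<Rightarrow> real"
    define x where "x = v 1 - v 2"
    have s0: "s \<ge> 0" using rho_pos by (simp add: s_def)
    \<comment> \<open>For small \<open>x\<close> the term \<open>s^2\<close> suffices. Otherwise one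
      indicator equals 1 and \<open>(x^2 - K)^2 >= 0\<close> bounds \<open>x^2\<close> by the other
      two terms.\<close>
    have "x\<^sup>2 \<le> s\<^sup>2 + K / 2 * (indicator {s<..} x + indicator {s<..} (- x)) + 1 / (2 * K) * x ^ 4"
    proof (cases "\<bar>x\<bar> \<le> s")
      case True
      then have "x\<^sup>2 \<le> s\<^sup>2" using abs_le_square_iff[of x s] s0 by simp
      moreover have "0 \<le> K / 2 * (indicator {s<..} x + indicator {s<..} (- x))" "0 \<le> 1 / (2 * K) * x ^ 4"
        using K by auto
      ultimately show ?thesis by linarith
    next
      case False
      have "0 \<le> (x\<^sup>2 - K)\<^sup>2 / (2 * K)" using K by simp
      also have "\<dots> = K / 2 + 1 / (2 * K) * x ^ 4 - x\<^sup>2"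
        using K by (simp add: field_simps power2_eq_square power4_eq_xxxx)
      finally have "x\<^sup>2 \<le> K / 2 * 1 + 1 / (2 * K) * x ^ 4" by simp
      also have "\<dots> \<le> K / 2 * (indicator {s<..} x + indicator {s<..} (- x)) + 1 / (2 * K) * x ^ 4"
        using False K by (intro add_right_mono mult_left_mono) (auto simp: indicator_def)
      finally show ?thesis using zero_le_power2[of s] by linarith
    qed
    then show "(v 1 - v 2)\<^sup>2 \<le> s\<^sup>2 + K / 2 * (indicator {s<..} (v 1 - v 2) + indicator {s<..} (v 2 - v 1))
      + 1 / (2 * K) * (v 1 - v 2) ^ 4" by (simp add: x_def)
  qed
  also have "\<dots> = s\<^sup>2 + K / 2 * (p + p) + 1 / (2 * K) * (\<integral>v. (v 1 - v 2) ^ 4 \<partial>U)"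
    using int integrable_diff_power[OF 12, of 4] by (simp add: p1 p2 del: One_nat_def)
  also have "\<dots> \<le> s\<^sup>2 + K / 2 * (p + p) + 1 / (2 * K) * (12 * \<rho> ^ 4 / (real m)\<^sup>2)"
    using K fourth_moment_le[OF q m] by (intro add_left_mono mult_left_mono) auto
  also have "1 / (2 * K) * (12 * \<rho> ^ 4 / (real m)\<^sup>2) = \<rho>\<^sup>2 / (2 * real q)"
    using m rho_pos unfolding K_def q2(2)
    by (simp add: field_simps power2_eq_square power4_eq_xxxx)
  finally have "2 * \<rho>\<^sup>2 / real q \<le> (1 + 48 * p) * (\<rho>\<^sup>2 / real q)"
    by (simp add: s2 K_def algebra_simps)
  then have "2 * (\<rho>\<^sup>2 / real q) \<le> (1 + 48 * p) * (\<rho>\<^sup>2 / real q)" by simp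
  then have "2 \<le> 1 + 48 * p"
    using rho_pos q2 by (subst (asm) mult_le_cancel_right) auto
  then show ?thesis by (simp add: p_def s_def)
qed

end

section \<open>Permutation orbits\<close>

lemma finite_perm_orbit: "finite (perm_orbit q y)"
proof -
  have "perm_orbit q y = (\<lambda>p. \<lambda>i\<in>{1..q}. y (p i)) ` {p. p permutes {1..q}}"
    by (auto simp: perm_orbit_def)
  then show ?thesis by (simp add: finite_permutations)
qed

lemma card_perm_orbit_pos: "card (perm_orbit q y) > 0"
proof -
  have "(\<lambda>i\<in>{1..q}. y (id i)) \<in> perm_orbit q y"
    unfolding perm_orbit_def using permutes_id by blast
  then show ?thesis using finite_perm_orbit card_gt_0_iff by blast
qed

lemma sum_perm_orbit:
  fixes f :: "real \<Rightarrow> real"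
  assumes "v \<in> perm_orbit q y"
  shows "(\<Sum>i=1..q. f (v i)) = (\<Sum>i=1..q. f (y i))"
proof -
  obtain p where p: "p permutes {1..q}" and v: "v = (\<lambda>i\<in>{1..q}. y (p i))"
    using assms unfolding perm_orbit_def by blast
  have "(\<Sum>i=1..q. f (v i)) = (\<Sum>i=1..q. f (y (p i)))"
    by (intro sum.cong refl) (simp add: v)
  also have "\<dots> = (\<Sum>i=1..q. f (y i))"
    by (rule sum.permute[OF p, unfolded o_def, symmetric])
  finally show ?thesis .
qed

lemma permutes_two_points:
  assumes "a \<in> S" "b \<in> S" "i \<in> S" "j \<in> S" "a \<noteq> b" "i \<noteq> j"
  obtains \<sigma> where "\<sigma> permutes S" "\<sigma> a = i" "\<sigma> b = j"
proof
  \<comment> \<open>The first swap sends \<open>a\<close> to \<open>i\<close> and \<open>b\<close>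
    to \<open>c\<close>. As \<open>c\<close> and \<open>j\<close> both differ from \<open>i\<close>,
    the second swap moves \<open>c\<close> to \<open>j\<close> and keeps \<open>i\<close>.\<close>
  define c where "c = Transposition.transpose a i b"
  show "Transposition.transpose c j \<circ> Transposition.transpose a i permutes S"
    using assms by (intro permutes_compose permutes_swap_id) (auto simp: c_def Transposition.transpose_def)
  show "(Transposition.transpose c j \<circ> Transposition.transpose a i) a = i"
    "(Transposition.transpose c j \<circ> Transposition.transpose a i) b = j"
    using assms by (auto simp: c_def Transposition.transpose_def)
qed

text \<open>Permuting the coordinates by some \<sigma> with \<open>\<sigma> a = i\<close> and
  \<open>\<sigma> b = j\<close> maps the orbit injectively to itself and carries the first set into
  the second.\<close>

lemma card_perm_orbit_tail_le:
  assumes "i \<in> {1..q}" "j \<in> {1..q}" "i \<noteq> j" "a \<in> {1..q}" "b \<in> {1..q}" "a \<noteq> b"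
  shows "card {v \<in> perm_orbit q y. s < v i - v j} \<le> card {v \<in> perm_orbit q y. s < v a - v b}"
proof -
  obtain \<sigma> where \<sigma>: "\<sigma> permutes {1..q}" "\<sigma> a = i" "\<sigma> b = j"
    using assms permutes_two_points[of a "{1..q}" b i j] by blast
  define g where "g v = (\<lambda>k\<in>{1..q}. v (\<sigma> k))" for v :: "nat \<Rightarrow> real"
  have g: "g v \<in> perm_orbit q y" if "v \<in> perm_orbit q y" for v
  proof -
    obtain p where p: "p permutes {1..q}" "v = (\<lambda>i\<in>{1..q}. y (p i))"
      using \<open>v \<in> perm_orbit q y\<close> unfolding perm_orbit_def by blast
    then have "g v = (\<lambda>i\<in>{1..q}. y ((p \<circ> \<sigma>) i))"
      using permutes_in_image[OF \<sigma>(1)] by (auto simp: g_def fun_eq_iff)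
    then show ?thesis
      unfolding perm_orbit_def using permutes_compose[OF \<sigma>(1) p(1)] by blast
  qed
  have inj: "inj_on g (vecs q)"
  proof (rule inj_onI, rule vecs_eqI)
    fix v w k assume gvw: "g v = g w" and k: "k \<in> {1..q}"
    obtain l where l: "l \<in> {1..q}" "k = \<sigma> l" using permutes_image[OF \<sigma>(1)] k by blast
    then show "v k = w k" using fun_cong[OF gvw, of l] by (simp add: g_def)
  qed
  have sub: "perm_orbit q y \<subseteq> vecs q" by (auto simp: perm_orbit_def vecs_def)
  show ?thesis
  proof (rule card_inj_on_le)
    show "inj_on g {v \<in> perm_orbit q y. s < v i - v j}"
      using inj by (rule inj_on_subset) (use sub in auto)
    show "g ` {v \<in> perm_orbit q y. s < v i - v j} \<subseteq> {v \<in> perm_orbit q y. s < v a - v b}"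
      using g assms by (auto simp: g_def \<sigma>)
  qed (simp add: finite_perm_orbit)
qed

lemma sum_abs_diff_le:
  fixes v :: "nat \<Rightarrow> real"
  shows "(\<Sum>i=1..q. \<Sum>j=1..q. \<bar>v i - v j\<bar>) \<le> 2 * real q * (\<Sum>i=1..q. \<bar>v i\<bar>)"
proof -
  have "(\<Sum>i=1..q. \<Sum>j=1..q. \<bar>v i - v j\<bar>) \<le> (\<Sum>i=1..q. \<Sum>j=1..q. \<bar>v i\<bar> + \<bar>v j\<bar>)"
    by (intro sum_mono abs_triangle_ineq4)
  also have "\<dots> = 2 * real q * (\<Sum>i=1..q. \<bar>v i\<bar>)"
    by (simp add: sum.distrib sum_distrib_left mult.assoc)
  finally show ?thesis .
qed

text \<open>
  The number of orbit points with \<open>v\<^sub>i - v\<^sub>j > s\<close> is the same for all \<open>i \<noteq> j\<close>, so it can be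
  averaged over all pairs, and for a single orbit point Markov's inequality applies.
\<close>

lemma perm_orbit_tail:
  assumes q: "q \<ge> 2" and s: "s > 0"
  shows "real (card {v \<in> perm_orbit q y. s < v 1 - v 2}) / real (card (perm_orbit q y))
    \<le> 2 * (\<Sum>i=1..q. \<bar>y i\<bar>) / ((real q - 1) * s)"
proof -
  define N where "N = perm_orbit q y"
  define c where "c = real (card {v \<in> N. s < v 1 - v 2})"
  note fin = finite_perm_orbit[of q y, folded N_def]
  have 12: "1 \<in> {1..q}" "2 \<in> {1..q}" "1 \<noteq> (2::nat)" using q by auto
  have ind: "real (card {v \<in> N. s < v i - v j}) = (\<Sum>v\<in>N. of_bool (s < v i - v j))" for i j
    using fin by (simp add: of_bool_def sum.If_cases Int_def)
  \<comment> \<open>Diagonal pairs are bounded below by 0, so the sum over all pairs yields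
    \<open>q (q - 1)\<close> copies of \<open>c\<close>.\<close>
  have cij: "(if i = j then 0 else c) \<le> (\<Sum>v\<in>N. of_bool (s < v i - v j))"
    if "i \<in> {1..q}" "j \<in> {1..q}" for i j
    using card_perm_orbit_tail_le[OF 12 that, of y s] fin
    by (auto simp: c_def N_def sum_nonneg simp flip: ind[unfolded N_def])
  have "real q * (real q - 1) * c = (\<Sum>i=1..q. \<Sum>j=1..q. c - (if i = j then c else 0))"
    by (simp add: sum_subtractf algebra_simps)
  also have "\<dots> = (\<Sum>i=1..q. \<Sum>j=1..q. if i = j then 0 else c)"
    by (intro sum.cong refl) auto
  also have "\<dots> \<le> (\<Sum>i=1..q. \<Sum>j=1..q. \<Sum>v\<in>N. of_bool (s < v i - v j))"
    by (intro sum_mono cij)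
  also have "\<dots> = (\<Sum>i=1..q. \<Sum>v\<in>N. \<Sum>j=1..q. of_bool (s < v i - v j))"
    by (rule sum.cong[OF refl], rule sum.swap)
  also have "\<dots> = (\<Sum>v\<in>N. \<Sum>i=1..q. \<Sum>j=1..q. of_bool (s < v i - v j))"
    by (rule sum.swap)
  also have "\<dots> \<le> (\<Sum>v\<in>N. \<Sum>i=1..q. \<Sum>j=1..q. \<bar>v i - v j\<bar> / s)"
    using s by (intro sum_mono) (auto simp: of_bool_def field_simps)
  also have "\<dots> = (\<Sum>v\<in>N. (\<Sum>i=1..q. \<Sum>j=1..q. \<bar>v i - v j\<bar>) / s)"
    by (simp only: sum_divide_distrib)
  also have "\<dots> \<le> (\<Sum>v\<in>N. (2 * real q * (\<Sum>i=1..q. \<bar>y i\<bar>)) / s)"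
  proof (intro sum_mono divide_right_mono)
    fix v assume "v \<in> N"
    then show "(\<Sum>i=1..q. \<Sum>j=1..q. \<bar>v i - v j\<bar>) \<le> 2 * real q * (\<Sum>i=1..q. \<bar>y i\<bar>)"
      using sum_abs_diff_le[of v q] sum_perm_orbit[of v q y abs] by (simp add: N_def)
  qed (use s in simp)
  also have "\<dots> = real q * (real (card N) * (2 * (\<Sum>i=1..q. \<bar>y i\<bar>) / s))" by simp
  finally have "real q * ((real q - 1) * c) \<le> real q * (real (card N) * (2 * (\<Sum>i=1..q. \<bar>y i\<bar>) / s))"
    by (simp only: mult.assoc)
  then have "(real q - 1) * c \<le> real (card N) * (2 * (\<Sum>i=1..q. \<bar>y i\<bar>) / s)"
    using q by (subst (asm) mult_le_cancel_left) auto
  then show ?thesis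
    using q s card_perm_orbit_pos[of q y] by (simp add: c_def N_def field_simps)
qed

section \<open>Norms of the maximal configurations\<close>

lemma b_seq_eq:
  "b_seq q k = sqrt (3 / (real q * (real q + 1))) * sqrt (real k * (real q - real k))"
  by (simp add: b_seq_def flip: real_sqrt_mult)

text \<open>Up to a common factor, the squares of \<open>b_seq q k\<close> and
  \<open>b_seq q (k - 1)\<close> differ by \<open>q + 1 - 2 k\<close>.\<close>

lemma b_seq_mono:
  assumes "1 \<le> k" "2 * k \<le> q + 1"
  shows "b_seq q (k - 1) \<le> b_seq q k"
proof -
  have "real (2 * k) \<le> real (q + 1)" using assms by (simp only: of_nat_le_iff)
  then have "real (k - 1) * (real q - real (k - 1)) \<le> real k * (real q - real k)"
    using assms by (simp add: of_nat_diff algebra_simps)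
  then show ?thesis unfolding b_seq_eq by (intro mult_left_mono) auto
qed

lemma b_seq_antimono:
  assumes "1 \<le> k" "q + 1 \<le> 2 * k"
  shows "b_seq q k \<le> b_seq q (k - 1)"
proof -
  have "real (q + 1) \<le> real (2 * k)" using assms by (simp only: of_nat_le_iff)
  then have "real k * (real q - real k) \<le> real (k - 1) * (real q - real (k - 1))"
    using assms by (simp add: of_nat_diff algebra_simps)
  then show ?thesis unfolding b_seq_eq by (intro mult_left_mono) auto
qed

text \<open>The sequence \<open>b_seq q\<close> rises from 0 up to index \<open>m\<close> and then
  falls back to 0, so the absolute increments telescope on each half to its peak value.\<close>

lemma sum_abs_a_hat:
  assumes q: "q = 2 * m"
  shows "(\<Sum>i=1..q. \<bar>a_hat q i\<bar>) = real q * sqrt (3 / (real q * (real q + 1)))"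
proof -
  have "(\<Sum>i=1..q. \<bar>a_hat q i\<bar>) = (\<Sum>i=1..m. \<bar>a_hat q i\<bar>) + (\<Sum>i=m+1..q. \<bar>a_hat q i\<bar>)"
    using sum.ub_add_nat[of 1 m "\<lambda>i. \<bar>a_hat q i\<bar>" m] q by (simp add: mult_2)
  also have "(\<Sum>i=1..m. \<bar>a_hat q i\<bar>) = (\<Sum>i=Suc 0..m. b_seq q i - b_seq q (i - 1))"
    using q b_seq_mono[of _ q] by (intro sum.cong) (auto simp: a_hat_def)
  also have "\<dots> = b_seq q m - b_seq q 0" by (rule sum_telescope'') simp
  also have "(\<Sum>i=m+1..q. \<bar>a_hat q i\<bar>) = (\<Sum>i=Suc m..q. - b_seq q i - - b_seq q (i - 1))"
    using q b_seq_antimono[of _ q] by (intro sum.cong) (auto simp: a_hat_def)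
  also have "\<dots> = - b_seq q q - - b_seq q m" using q by (intro sum_telescope'') simp
  also have "b_seq q m - b_seq q 0 + (- b_seq q q - - b_seq q m) = 2 * b_seq q m"
    by (simp add: b_seq_def)
  also have "b_seq q m = sqrt (3 / (real q * (real q + 1))) * real m"
    using q by (simp add: b_seq_eq)
  finally show ?thesis using q by simp
qed

text \<open>The difference of squares \<open>x^2 - y^2\<close> is at least \<open>c q / 2\<close> in
  the first quarter of the range, and it is at most \<open>2 x (x - y)\<close> where
  \<open>x^2\<close> is at most \<open>c k q\<close>. Thus a steep increment near the end has square
  of order \<open>c q / k\<close>.\<close>

lemma a_hat_square_ge:
  assumes q: "q = 4 * n" and k: "1 \<le> k" "k \<le> n"
  shows "(a_hat q k)\<^sup>2 \<ge> 3 / (real q * (real q + 1)) * (real q / 16) * (1 / real k)"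
proof -
  define c where "c = 3 / (real q * (real q + 1))"
  have qr: "real q \<ge> 4 * real k" "real k \<ge> 1" using q k by auto
  have c: "c > 0" using qr by (simp add: c_def)
  define x where "x = b_seq q k"
  define y where "y = b_seq q (k - 1)"
  have x2: "x\<^sup>2 = c * (real k * (real q - real k))"
    using qr c by (simp add: x_def b_seq_eq power_mult_distrib flip: c_def)
  have y2: "y\<^sup>2 = c * ((real k - 1) * (real q - real k + 1))"
    using qr c k by (simp add: y_def b_seq_eq power_mult_distrib of_nat_diff flip: c_def)
  have xy: "0 \<le> y" "y \<le> x"
    using k q b_seq_mono[of k q] by (auto simp: x_def y_def b_seq_eq)
  have "c * (real q / 2) \<le> c * (real q - 2 * real k + 1)"
    using qr c by (intro mult_left_mono) auto
  also have "\<dots> = x\<^sup>2 - y\<^sup>2" unfolding x2 y2 by (simp add: algebra_simps)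
  also have "\<dots> = (x + y) * (x - y)" by (simp add: power2_eq_square algebra_simps)
  also have "\<dots> \<le> (2 * x) * (x - y)" using xy by (intro mult_right_mono) auto
  finally have "(c * (real q / 2))\<^sup>2 \<le> ((2 * x) * (x - y))\<^sup>2"
    using c by (intro power_mono) auto
  also have "\<dots> = 4 * x\<^sup>2 * (x - y)\<^sup>2" by (simp add: power_mult_distrib)
  also have "\<dots> \<le> 4 * (c * (real k * real q)) * (x - y)\<^sup>2"
    unfolding x2 using c qr by (intro mult_right_mono mult_left_mono) auto
  finally have "(c * (real q / 2))\<^sup>2 \<le> 4 * (c * (real k * real q)) * (x - y)\<^sup>2" .
  then have "(c * (real q / 2))\<^sup>2 / (4 * (c * (real k * real q))) \<le> (x - y)\<^sup>2"
    using c qr by (subst pos_divide_le_eq) (auto simp: mult_ac)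
  also have "(c * (real q / 2))\<^sup>2 / (4 * (c * (real k * real q))) = c * (real q / 16) * (1 / real k)"
    using c qr by (simp add: field_simps power2_eq_square)
  also have "(x - y)\<^sup>2 = (a_hat q k)\<^sup>2"
    using k q by (simp add: a_hat_def x_def y_def power2_commute)
  finally show ?thesis by (simp add: c_def)
qed

text \<open>Summing the terms of order \<open>1 / k\<close> produces a harmonic number, the source
  of the divergence.\<close>

lemma inner_q_a_hat_ge:
  assumes q: "q = 4 * n"
  shows "inner_q q (a_hat q) (a_hat q) \<ge> 3 / (real q * (real q + 1)) * (real q / 16) * harm n"
proof -
  have "3 / (real q * (real q + 1)) * (real q / 16) * harm n
      = (\<Sum>k=1..n. 3 / (real q * (real q + 1)) * (real q / 16) * (1 / real k))"
    by (simp add: harm_def sum_distrib_left inverse_eq_divide)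
  also have "\<dots> \<le> (\<Sum>k=1..n. (a_hat q k)\<^sup>2)"
    by (intro sum_mono a_hat_square_ge[OF q]) auto
  also have "\<dots> \<le> (\<Sum>k=1..q. (a_hat q k)\<^sup>2)"
    using q by (intro sum_mono2) auto
  also have "\<dots> = inner_q q (a_hat q) (a_hat q)" by (simp add: inner_q_def power2_eq_square)
  finally show ?thesis .
qed

section \<open>Transfer to \<open>y_hat\<close> and its permutation orbit\<close>

lemma norm_y_hat_pos:
  assumes "q \<ge> 3"
  shows "norm_q q (y_hat q) > 0"
proof -
  have "1 < real q ^ 2" using assms by (intro one_less_power) auto
  then show ?thesis using assms by (simp add: norm_y_hat)
qed

lemma sum_abs_y_hat:
  assumes "q \<ge> 3"
  shows "(\<Sum>i=1..q. \<bar>y_hat q i\<bar>)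
    = norm_q q (y_hat q) * ((\<Sum>i=1..q. \<bar>a_hat q i\<bar>) / norm_q q (a_hat q))"
proof -
  have "(\<Sum>i=1..q. \<bar>y_hat q i\<bar>)
      = (\<Sum>i=1..q. norm_q q (y_hat q) * (\<bar>a_hat q i\<bar> / norm_q q (a_hat q)))"
  proof (intro sum.cong refl)
    fix i assume "i \<in> {1..q}"
    then have "y_hat q i = norm_q q (y_hat q) * (a_hat q i / norm_q q (a_hat q))"
      unfolding norm_y_hat[OF assms] by (simp add: y_hat_def)
    then show "\<bar>y_hat q i\<bar> = norm_q q (y_hat q) * (\<bar>a_hat q i\<bar> / norm_q q (a_hat q))"
      using norm_y_hat_pos[OF assms] norm_a_hat_pos[OF assms] by (simp add: abs_mult)
  qed
  then show ?thesis by (simp only: sum_distrib_left sum_divide_distrib)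
qed

text \<open>In the Markov bound the scalings \<rho> and \<kappa> cancel. What remains is the ratio
  of the 1-norm to \<open>sqrt q\<close> times the Euclidean norm, which is of order
  \<open>1 / sqrt (harm n)\<close>.\<close>

lemma perm_orbit_y_hat_tail:
  assumes q: "q = 4 * n" and n: "n \<ge> 1"
  shows "real (card {v \<in> perm_orbit q (y_hat q). norm_q q (y_hat q) / sqrt (2 * real q) < v 1 - v 2})
      / real (card (perm_orbit q (y_hat q))) \<le> 16 * sqrt 2 / sqrt (harm n)"
proof -
  define \<rho> where "\<rho> = norm_q q (y_hat q)"
  define \<kappa> where "\<kappa> = sqrt (3 / (real q * (real q + 1)))"
  define r where "r = real q"
  define H :: real where "H = sqrt (harm n)"
  define A where "A = norm_q q (a_hat q)"
  have q3: "q \<ge> 3" and r: "r \<ge> 2" using q n by (auto simp: r_def)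
  have \<rho>: "\<rho> > 0" unfolding \<rho>_def by (rule norm_y_hat_pos[OF q3])
  have \<kappa>: "\<kappa> > 0" using r by (simp add: \<kappa>_def r_def)
  have H: "H > 0" using n by (simp add: H_def harm_pos)
  have "\<kappa> * (sqrt r / 4) * H = sqrt (3 / (real q * (real q + 1)) * (real q / 16) * harm n)"
    by (simp add: \<kappa>_def r_def H_def real_sqrt_mult real_sqrt_divide)
  also have "\<dots> \<le> A" unfolding A_def norm_q_def
    by (intro real_sqrt_le_mono inner_q_a_hat_ge q)
  finally have A: "\<kappa> * (sqrt r / 4) * H \<le> A" .
  have pos: "\<kappa> * (sqrt r / 4) * H > 0" using \<kappa> H r by simp
  have A0: "A > 0" using pos A by linarith
  have alg: "2 * (\<rho> * (r * \<kappa> / A)) / (z * (\<rho> / S)) = 2 * S * (r / z) * (\<kappa> / A)"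
    if "z > 0" "S > 0" for z S
    using that \<rho> A0 by (simp add: field_simps)
  have "real (card {v \<in> perm_orbit q (y_hat q). \<rho> / sqrt (2 * r) < v 1 - v 2})
      / real (card (perm_orbit q (y_hat q)))
      \<le> 2 * (\<Sum>i=1..q. \<bar>y_hat q i\<bar>) / ((r - 1) * (\<rho> / sqrt (2 * r)))"
    unfolding r_def using \<rho> r q3 by (intro perm_orbit_tail) (auto simp: r_def)
  also have "(\<Sum>i=1..q. \<bar>y_hat q i\<bar>) = \<rho> * (r * \<kappa> / A)"
    using sum_abs_y_hat[OF q3] sum_abs_a_hat[of q "2 * n"] q
    by (simp add: \<rho>_def r_def \<kappa>_def A_def)
  also have "2 * (\<rho> * (r * \<kappa> / A)) / ((r - 1) * (\<rho> / sqrt (2 * r)))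
      = 2 * sqrt (2 * r) * (r / (r - 1)) * (\<kappa> / A)"
    using r by (intro alg) auto
  \<comment> \<open>Uses \<open>r / (r - 1) <= 2\<close>, valid for \<open>r >= 2\<close>, and the
    lower bound for \<open>A\<close>.\<close>
  also have "\<dots> \<le> 2 * sqrt (2 * r) * 2 * (\<kappa> / (\<kappa> * (sqrt r / 4) * H))"
    using r \<kappa> H A A0 pos by (intro mult_mono divide_left_mono mult_pos_pos) (auto simp: field_simps)
  also have "\<dots> = 16 * sqrt 2 / H"
    using \<kappa> r H by (simp add: real_sqrt_mult field_simps)
  finally show ?thesis by (simp add: \<rho>_def r_def H_def)
qed

section \<open>Discrepancy\<close>

lemma diff_cap:
  assumes q: "q \<ge> 2" and \<rho>: "\<rho> > 0"
  shows "{v \<in> hyp_sphere q \<rho>. \<rho> / sqrt (2 * real q) < v 1 - v 2} \<in> caps q \<rho>"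
proof -
  \<comment> \<open>The scaling gives \<open>w\<close> norm \<rho>. The height \<open>t\<close> is
    then forced by \<open>\<rho>^2 t = (\<rho> / sqrt 2) (\<rho> / sqrt (2 q))\<close>.\<close>
  define w where "w = vec_scale q (\<rho> / sqrt 2) (diff_vec q 1 2)"
  define t where "t = 1 / (2 * sqrt (real q))"
  have 12: "1 \<in> {1..q}" "2 \<in> {1..q}" "1 \<noteq> (2::nat)" using q by auto
  have "inner_q q w w = \<rho>\<^sup>2"
    unfolding w_def inner_q_vec_scale inner_q_diff_vec_self[OF 12] by (simp add: power_divide)
  moreover have "w \<in> hyp q" unfolding w_def by (intro vec_scale_hyp diff_vec_hyp 12)
  ultimately have w: "w \<in> hyp_sphere q \<rho>" using \<rho> by (simp add: hyp_sphere_iff)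
  define r where "r = sqrt (real q)"
  have "1 \<le> r" using q by (simp add: r_def)
  then have t: "-1 \<le> t" "t < 1" by (auto simp: t_def field_simps simp flip: r_def)
  have "\<rho>\<^sup>2 * t = \<rho> / sqrt 2 * (\<rho> / sqrt (2 * real q))"
    by (simp add: t_def power2_eq_square real_sqrt_mult)
  then have "inner_q q v w > \<rho>\<^sup>2 * t \<longleftrightarrow> \<rho> / sqrt (2 * real q) < v 1 - v 2" for v
    unfolding w_def inner_q_vec_scale_right inner_q_diff_vec[OF 12(1,2)]
    using \<rho> by (simp only: mult_less_cancel_left_pos divide_pos_pos real_sqrt_gt_zero zero_less_numeral)
  then have "{v \<in> hyp_sphere q \<rho>. \<rho> / sqrt (2 * real q) < v 1 - v 2} = cap q \<rho> w t"
    by (simp add: cap_def)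
  then show ?thesis unfolding caps_def using w t by blast
qed

text \<open>Both proportions lie between 0 and 1, so the set of deviations is bounded and each
  member is below the supremum.\<close>

lemma cap_discrepancy_ge:
  assumes q: "q \<ge> 2" and \<rho>: "\<rho> > 0" and N: "finite N" and C: "C \<in> caps q \<rho>"
  shows "measure (unif_sphere q \<rho>) C - real (card (N \<inter> C)) / real (card N)
    \<le> cap_discrepancy q \<rho> N"
proof -
  interpret invariant_sphere q \<rho> "unif_sphere q \<rho>"
    by unfold_locales (intro rotation_invariant_unif_sphere q \<rho>, rule \<rho>)
  let ?f = "\<lambda>C. \<bar>real (card (N \<inter> C)) / real (card N) - measure (unif_sphere q \<rho>) C\<bar>"
  have "?f C \<le> 1" for C
  proof -
    have "card (N \<inter> C) \<le> card N" using N by (intro card_mono) auto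
    then have "real (card (N \<inter> C)) / real (card N) \<le> 1"
      by (auto simp: divide_le_eq_1)
    moreover have "0 \<le> real (card (N \<inter> C)) / real (card N)" by simp
    ultimately show ?thesis
      using prob_le_1[of C] measure_nonneg[of "unif_sphere q \<rho>" C] by linarith
  qed
  then have "bdd_above (?f ` caps q \<rho>)" by (intro bdd_aboveI2[where M = 1])
  then have "?f C \<le> cap_discrepancy q \<rho> N"
    unfolding cap_discrepancy_def by (rule cSUP_upper[OF C])
  then show ?thesis by linarith
qed

text \<open>One cap suffices: its uniform measure is at least \<open>1 / 48\<close>, while its share
  of the orbit is at most \<open>16 sqrt 2 / sqrt (harm n)\<close>.\<close>

lemma cap_discrepancy_y_hat_ge:
  assumes q: "q = 4 * n" and n: "n \<ge> 1"
  shows "1 / 48 - 16 * sqrt 2 / sqrt (harm n)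
    \<le> cap_discrepancy q (norm_q q (y_hat q)) (perm_orbit q (y_hat q))"
proof -
  define \<rho> where "\<rho> = norm_q q (y_hat q)"
  let ?N = "perm_orbit q (y_hat q)"
  define C where "C = {v \<in> hyp_sphere q \<rho>. \<rho> / sqrt (2 * real q) < v 1 - v 2}"
  have q2: "q \<ge> 2" "q \<ge> 3" using q n by auto
  have \<rho>: "\<rho> > 0" unfolding \<rho>_def by (rule norm_y_hat_pos[OF q2(2)])
  interpret invariant_sphere q \<rho> "unif_sphere q \<rho>"
    by unfold_locales (intro rotation_invariant_unif_sphere q2(1) \<rho>, rule \<rho>)
  have "real (card (?N \<inter> C)) / real (card ?N)
      \<le> real (card {v \<in> ?N. \<rho> / sqrt (2 * real q) < v 1 - v 2}) / real (card ?N)"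
    by (intro divide_right_mono of_nat_mono card_mono) (auto simp: C_def finite_perm_orbit)
  also have "\<dots> \<le> 16 * sqrt 2 / sqrt (harm n)"
    unfolding \<rho>_def by (rule perm_orbit_y_hat_tail[OF q n])
  finally have "real (card (?N \<inter> C)) / real (card ?N) \<le> 16 * sqrt 2 / sqrt (harm n)" .
  moreover have "1 / 48 \<le> measure (unif_sphere q \<rho>) C"
    unfolding C_def by (rule diff_tail[of "2 * n"]) (use q n in auto)
  moreover have "measure (unif_sphere q \<rho>) C - real (card (?N \<inter> C)) / real (card ?N)
      \<le> cap_discrepancy q \<rho> ?N"
    unfolding C_def by (intro cap_discrepancy_ge q2(1) \<rho> finite_perm_orbit diff_cap)
  ultimately show ?thesis by (simp add: \<rho>_def)
qed

theorem proposition4p7: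
  shows "\<not> APU_hyp y_hat \<and> \<not> APU x_hat"
proof -
  have "\<not> APU_hyp y_hat"
  proof
    assume "APU_hyp y_hat"
    then have "(\<lambda>q. cap_discrepancy q (norm_q q (y_hat q)) (perm_orbit q (y_hat q))) \<longlonglongrightarrow> 0"
      by (simp add: APU_hyp_def)
    \<comment> \<open>The lower bound is available for multiples of 4. Along this subsequence it
      tends to \<open>1 / 48\<close>, because the harmonic numbers diverge.\<close>
    moreover have "filterlim (\<lambda>n::nat. 4 * n) at_top sequentially"
      by (rule filterlim_subseq) (simp add: strict_mono_def)
    ultimately have "(\<lambda>n. cap_discrepancy (4 * n) (norm_q (4 * n) (y_hat (4 * n)))
        (perm_orbit (4 * n) (y_hat (4 * n)))) \<longlonglongrightarrow> 0"
      by (rule filterlim_compose)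
    moreover have "(\<lambda>n. 1 / 48 - 16 * sqrt 2 / sqrt (harm n)) \<longlonglongrightarrow> 1 / 48 - 0"
      by (intro tendsto_diff tendsto_const tendsto_divide_0[OF tendsto_const]
          filterlim_at_top_imp_at_infinity filterlim_compose[OF sqrt_at_top harm_at_top])
    moreover have "\<forall>\<^sub>F n in sequentially. 1 / 48 - 16 * sqrt 2 / sqrt (harm n)
        \<le> cap_discrepancy (4 * n) (norm_q (4 * n) (y_hat (4 * n)))
            (perm_orbit (4 * n) (y_hat (4 * n)))"
      using eventually_ge_at_top[of 1] by eventually_elim (rule cap_discrepancy_y_hat_ge[OF refl])
    ultimately have "1 / 48 - 0 \<le> (0 :: real)"
      by (intro tendsto_le[OF sequentially_bot])
    then show False by simp
  qed
  \<comment> \<open>The projection of \<open>x_hat\<close> to the hyperplane is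
    \<open>y_hat\<close>, so both claims coincide.\<close>
  then show ?thesis by (simp add: APU_def proj_x_hat)
qed

end
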